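(* Let $\Delta\subset\mathbb{C}$ be an open subset and let $F_t:(\mathbb{C}^n,0)\to(\mathbb{C},0)$, $F_t(x)=f(x)+tg(x)$, $t\in\Delta$, be a family of germs of polynomials with isolated singularity such that all $F_t$ share the same Newton diagram. Let $h_t(x)=h(t,x)$ be an analytic family of control functions of the form $$h(t,x)=\sum_{i=1}^nP_i(t,x)\frac{\partial F_t}{\partial x_i}(x),$$ where each $P_i$ is an analytic family of germs of mixed polynomials, and suppose the Newton diagram of $h_t$ is independent of $t$. If for every $(n-1)$-dimensional compact face $\sigma$ of $\Gamma(h)$ and every $i=1,\dots,n$, $$\mathrm{fil}_{w_\sigma}(g)+\mathrm{fil}_{w_\sigma}(P_i)-\mathrm{fil}_{w_\sigma}(h)-w_{\sigma,*}\ge0,$$ where $w_\sigma$ is a weight associated to $\sigma$, then the family $F_t$ is Lipschitz trivial over $\Delta$.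
   Context: A mixed polynomial is a function $p:\mathbb{C}^n\to\mathbb{C}$ of the form $p=\sum_{\nu,\mu}c_{\nu,\mu}x^\nu\bar x^\mu$ (finite sum, $\nu,\mu\in\mathbb{N}^n$, $c_{\nu,\mu}\in\mathbb{C}^*$). An analytic family of mixed polynomials is $p(t,x)=\sum_{\nu,\mu}c_{\nu,\mu}(t)x^\nu\bar x^\mu$ with $c_{\nu,\mu}(t)\not\equiv0$ analytic in $t$. For a weight $w\in\mathbb{Q}_{\ge0}^n$, $\mathrm{fil}_w(x^\nu\bar x^\mu)=\sum_jw_j(\nu_j+\mu_j)$, and $\mathrm{fil}_w(p)$ is the minimum of $\mathrm{fil}_w$ over the mixed monomials appearing in $p$ (for a family: those with $c_{\nu,\mu}\not\equiv0$). The support is $\mathrm{supp}(p)=\{\nu+\mu:c_{\nu,\mu}\ne0\}$ (for a family: $c_{\nu,\mu}\not\equiv 0$). The Newton polyhedron $\Gamma_+(p)$ is the convex hull of $\bigcup_{\alpha\in\mathrm{supp}(p)}(\alpha+\mathbb{R}_{\ge0}^n)$; the Newton diagram $\Gamma(p)$ is the union of the compact faces of $\Gamma_+(p)$; it is convenient if it meets every coordinate axis; $V(\Gamma(p))$ is its set of vertices. A weight associated to an $(n-1)$-dimensional face $\sigma$ is a nonzero vector $w_\sigma\in\mathbb{Q}_{\ge0}^n$ orthogonal to the affine hyperplane containing $\sigma$; $w_{\sigma,*}$ is the maximum of its entries. A control function is a nonzero mixed polynomial $h:\mathbb{C}^n\to\mathbb{C}$ such that (i) $\Gamma(h)$ is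 convenient, and (ii) near the origin $|h|\sim\rho_{\Gamma(h)}$, where $\rho_{\Gamma(h)}(x)=\sum_{\alpha\in V(\Gamma(h))}|x_1|^{\alpha_1}\cdots|x_n|^{\alpha_n}$ (here $\varphi\sim\psi$ means that each is bounded by a positive constant times the other). The family $F_t$ is Lipschitz trivial over $\Delta$ if for each $t_0\in\Delta$ there are a neighbourhood $U_{t_0}\subset\Delta$ of $t_0$ and a continuous family of bi-Lipschitz homeomorphisms $\phi_t:(\mathbb{C}^n,0)\to(\mathbb{C}^n,0)$, $t\in U_{t_0}$, such that $F_t(\phi_t(x))=F_{t_0}(x)$ for all $x$ in a neighbourhood of $0$ and all $t\in U_{t_0}$. *)

theory Defs
  imports
    "HOL-Analysis.Analysis"
    "HOL-Library.Poly_Mapping"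
    "HOL-Library.Landau_Symbols"
begin

section \<open>Mixed polynomials\<close>

text \<open>
  A mixed polynomial in the variables \<open>x\<^sub>j\<close>, indexed by a finite type \<open>'n\<close>, is given by its
  coefficients \<open>c\<^sub>\<nu>\<^sub>\<mu>\<close>: the pair \<open>(\<nu>, \<mu>)\<close> is the mixed monomial with holomorphic exponent \<open>\<nu>\<close> and
  antiholomorphic exponent \<open>\<mu>\<close>. The coefficients are determined by the function.
\<close>

type_synonym 'n exponent = "(nat, 'n) vec"

type_synonym 'n mixed_poly = "('n exponent \<times> 'n exponent) \<Rightarrow>\<^sub>0 complex"

definition mixed_eval :: "'n::finite mixed_poly \<Rightarrow> complex ^ 'n \<Rightarrow> complex" where
  "mixed_eval p x =
    (\<Sum>(\<nu>, \<mu>)\<in>Poly_Mapping.keys p.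
       Poly_Mapping.lookup p (\<nu>, \<mu>) * (\<Prod>j\<in>UNIV. (x $ j) ^ (\<nu> $ j) * cnj (x $ j) ^ (\<mu> $ j)))"

definition ordinary_poly :: "'n::finite mixed_poly \<Rightarrow> bool" where
  "ordinary_poly p \<longleftrightarrow> (\<forall>(\<nu>, \<mu>)\<in>Poly_Mapping.keys p. \<mu> = 0)"

definition partial_deriv :: "'n::finite \<Rightarrow> (complex ^ 'n \<Rightarrow> complex) \<Rightarrow> complex ^ 'n \<Rightarrow> complex" where
  "partial_deriv i \<phi> x = deriv (\<lambda>z. \<phi> (\<chi> j. if j = i then z else x $ j)) (x $ i)"

definition isolated_singularity :: "(complex ^ 'n::finite \<Rightarrow> complex) \<Rightarrow> bool" where
  "isolated_singularity \<phi> \<longleftrightarrow>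
    (\<forall>i. partial_deriv i \<phi> 0 = 0) \<and> (\<forall>\<^sub>F x in at 0. \<exists>i. partial_deriv i \<phi> x \<noteq> 0)"


section \<open>Analytic families\<close>

definition analytic_family :: "complex set \<Rightarrow> (complex \<Rightarrow> 'n::finite mixed_poly) \<Rightarrow> bool" where
  "analytic_family \<Delta> p \<longleftrightarrow>
    finite (\<Union>t\<in>\<Delta>. Poly_Mapping.keys (p t)) \<and>
    (\<forall>k. (\<lambda>t. Poly_Mapping.lookup (p t) k) analytic_on \<Delta>)"

text \<open>The mixed monomials whose coefficient does not vanish identically on \<open>\<Delta>\<close>.\<close>

definition family_monomials ::
    "complex set \<Rightarrow> (complex \<Rightarrow> 'n::finite mixed_poly) \<Rightarrow> ('n exponent \<times> 'n exponent) set" where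
  "family_monomials \<Delta> p = (\<Union>t\<in>\<Delta>. Poly_Mapping.keys (p t))"


section \<open>Filtrations and Newton diagrams\<close>

text \<open>
  The notions below depend only on the set \<open>M\<close> of mixed monomials that appear; they are applied
  to \<open>Poly_Mapping.keys p\<close> for a single mixed polynomial and to \<open>family_monomials\<close> for a family.
  The filtration is extended real valued so that it is \<open>\<infinity>\<close> on the zero polynomial; on a nonempty
  finite \<open>M\<close> the infimum is a minimum.
\<close>

definition fil :: "real ^ 'n \<Rightarrow> ('n::finite exponent \<times> 'n exponent) set \<Rightarrow> ereal" where
  "fil w M = (INF (\<nu>, \<mu>)\<in>M. ereal (\<Sum>j\<in>UNIV. w $ j * real (\<nu> $ j + \<mu> $ j)))"

definition supp :: "('n::finite exponent \<times> 'n exponent) set \<Rightarrow> 'n exponent set" where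
  "supp M = (\<lambda>(\<nu>, \<mu>). \<nu> + \<mu>) ` M"

definition real_exponent :: "'n::finite exponent \<Rightarrow> real ^ 'n" where
  "real_exponent \<alpha> = (\<chi> j. real (\<alpha> $ j))"

definition newton_polyhedron :: "('n::finite exponent \<times> 'n exponent) set \<Rightarrow> (real ^ 'n) set" where
  "newton_polyhedron M =
    convex hull (\<Union>\<alpha>\<in>supp M. {real_exponent \<alpha> + v | v. \<forall>j. 0 \<le> v $ j})"

definition newton_diagram :: "('n::finite exponent \<times> 'n exponent) set \<Rightarrow> (real ^ 'n) set" where
  "newton_diagram M = \<Union>{\<sigma>. \<sigma> face_of newton_polyhedron M \<and> compact \<sigma>}"

definition convenient :: "('n::finite exponent \<times> 'n exponent) set \<Rightarrow> bool" where
  "convenient M \<longleftrightarrow> (\<forall>i. \<exists>s. axis i s \<in> newton_diagram M)"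

text \<open>
  Every vertex of the Newton polyhedron lies in the support, so no vertex is lost by ranging over
  natural exponents. This keeps the exponents in \<open>rho\<close> natural, with \<open>0 ^ 0 = 1\<close>, whereas
  \<open>0 powr 0 = 0\<close>.
\<close>

definition newton_vertices :: "('n::finite exponent \<times> 'n exponent) set \<Rightarrow> 'n exponent set" where
  "newton_vertices M = {\<alpha>. real_exponent \<alpha> extreme_point_of newton_polyhedron M}"

definition compact_facet :: "(real ^ 'n) set \<Rightarrow> ('n::finite exponent \<times> 'n exponent) set \<Rightarrow> bool" where
  "compact_facet \<sigma> M \<longleftrightarrow>
    \<sigma> face_of newton_polyhedron M \<and> compact \<sigma> \<and> aff_dim \<sigma> = int CARD('n) - 1"

text \<open>For a face of dimension \<open>n - 1\<close>, the affine hull is the affine hyperplane containing it.\<close>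

definition associated_weight :: "real ^ 'n::finite \<Rightarrow> (real ^ 'n) set \<Rightarrow> bool" where
  "associated_weight w \<sigma> \<longleftrightarrow>
    w \<noteq> 0 \<and> (\<forall>j. w $ j \<in> \<rat> \<and> 0 \<le> w $ j) \<and>
    (\<forall>x\<in>affine hull \<sigma>. \<forall>y\<in>affine hull \<sigma>. w \<bullet> (x - y) = 0)"

definition max_weight :: "real ^ 'n::finite \<Rightarrow> real" where
  "max_weight w = Max (range (\<lambda>j. w $ j))"


section \<open>Control functions\<close>

definition rho :: "('n::finite exponent \<times> 'n exponent) set \<Rightarrow> complex ^ 'n \<Rightarrow> real" where
  "rho M x = (\<Sum>\<alpha>\<in>newton_vertices M. \<Prod>j\<in>UNIV. cmod (x $ j) ^ (\<alpha> $ j))"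

definition control_function :: "'n::finite mixed_poly \<Rightarrow> bool" where
  "control_function h \<longleftrightarrow>
    h \<noteq> 0 \<and>
    convenient (Poly_Mapping.keys h) \<and>
    (\<lambda>x. cmod (mixed_eval h x)) \<in> \<Theta>[nhds 0](rho (Poly_Mapping.keys h))"


section \<open>Lipschitz triviality\<close>

definition bilipschitz_homeo ::
    "'a::metric_space set \<Rightarrow> 'b::metric_space set \<Rightarrow> ('a \<Rightarrow> 'b) \<Rightarrow> bool" where
  "bilipschitz_homeo V W \<phi> \<longleftrightarrow>
    (\<exists>\<psi> K L. homeomorphism V W \<phi> \<psi> \<and> K-lipschitz_on V \<phi> \<and> L-lipschitz_on W \<psi>)"

text \<open>
  The germs \<open>\<phi>\<^sub>t : (\<complex>\<^sup>n, 0) \<rightarrow> (\<complex>\<^sup>n, 0)\<close> are represented on one neighbourhood \<open>V\<close> of the origin,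
  common to all \<open>t \<in> U\<close>; each maps \<open>V\<close> onto a neighbourhood \<open>W\<close> of the origin that may depend
  on \<open>t\<close>. Continuity of the family is joint continuity in \<open>(t, x)\<close>.
\<close>

definition lipschitz_trivial ::
    "complex set \<Rightarrow> (complex \<Rightarrow> complex ^ 'n::finite \<Rightarrow> complex) \<Rightarrow> bool" where
  "lipschitz_trivial \<Delta> F \<longleftrightarrow>
    (\<forall>t0\<in>\<Delta>. \<exists>U V \<phi>.
       open U \<and> t0 \<in> U \<and> U \<subseteq> \<Delta> \<and> open V \<and> 0 \<in> V \<and>
       continuous_on (U \<times> V) (\<lambda>(t, x). \<phi> t x) \<and>
       (\<forall>t\<in>U. \<phi> t 0 = 0 \<and> (\<exists>W. open W \<and> bilipschitz_homeo V W (\<phi> t)) \<and>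
              (\<forall>x\<in>V. F t (\<phi> t x) = F t0 x)))"

end

theory Submission
  imports Defs
begin

text \<open>
  The vector field \<open>v\<^sub>i = - g P\<^sub>i / h\<close> satisfies \<open>g + \<Sum>\<^sub>i v\<^sub>i \<partial>F\<^sub>t/\<partial>x\<^sub>i = 0\<close>, so \<open>F\<^sub>t\<close> is constant
  along its flow, and the flow is bi-Lipschitz once \<open>v\<close> is Lipschitz in \<open>x\<close>. By the filtration
  hypothesis, the exponent of every derivative of a monomial of \<open>g P\<^sub>i\<close> satisfies the inequalities
  of all compact facets of the Newton polyhedron of \<open>h\<close>; as \<open>h\<close> is convenient, it therefore lies in
  that polyhedron, and the monomial is bounded by \<open>rho\<close>. Likewise the monomials of \<open>g P\<^sub>i \<partial>h\<close>
  are bounded by \<open>rho\<^sup>2\<close>. Since \<open>|h|\<close> dominates \<open>rho\<close>, uniformly for nearby parameters, the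
  derivatives of \<open>v\<close> are bounded off the origin.
\<close>

section \<open>Newton polyhedra\<close>

text \<open>The obstacle is the origin: \<open>h\<close> vanishes there together with all partial
  derivatives of \<open>F\<close>, so differentiability of the field is available only off the
  origin, and the mean value theorem covers only segments that avoid it. At 0 it is replaced by
  |v(x)| <= L |x|, which needs that \<open>g\<close> has no constant term; this holds because two
  members of the pencil vanish at 0, hence so does \<open>g\<close>. The square of
  \<open>rho\<close> matches the denominator of the quotient rule. The parameter is complex while
  \<open>v\<close> involves conjugates, so no holomorphic flow is available: for each
  \<open>t\<close> a real equation is solved along the segment from \<open>t0\<close> to
  \<open>t\<close>, with velocity \<open>(t - t0) v\<close>. On a small ball of parameters the flow
  is the identity plus a map with Lipschitz constant 1/2, which yields the inverse and its Lipschitz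
  bound without flowing backwards.\<close>

lemma newton_polyhedron_nonneg:
  fixes M :: "('n::finite exponent \<times> 'n exponent) set"
  assumes "y \<in> newton_polyhedron M"
  shows "0 \<le> y $ j"
proof -
  have "convex {y::real^'n. 0 \<le> y $ j}"
    using convex_halfspace_ge[of 0 "axis j (1::real)"] by (simp add: inner_axis')
  then have "newton_polyhedron M \<subseteq> {y. 0 \<le> y $ j}"
    unfolding newton_polyhedron_def
    by (intro hull_minimal) (auto simp: real_exponent_def)
  then show ?thesis using assms by auto
qed

lemma convex_newton_polyhedron: "convex (newton_polyhedron M)"
  by (simp add: newton_polyhedron_def convex_convex_hull)

lemma real_exponent_plus_in_newton_polyhedron:
  assumes "\<alpha> \<in> supp M" "\<And>j. 0 \<le> v $ j"
  shows "real_exponent \<alpha> + v \<in> newton_polyhedron M"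
  unfolding newton_polyhedron_def using assms by (intro hull_inc) auto

lemma real_exponent_in_newton_polyhedron:
  "\<alpha> \<in> supp M \<Longrightarrow> real_exponent \<alpha> \<in> newton_polyhedron M"
  using real_exponent_plus_in_newton_polyhedron[of \<alpha> M 0] by simp

text \<open>The points that a vector \<open>v\<close> carries into the polyhedron form a convex set;
  for \<open>v\<close> in the nonnegative orthant it contains every generating orthant, hence the
  hull.\<close>

lemma newton_polyhedron_upward_closed:
  assumes "y \<in> newton_polyhedron M" "\<And>j. y $ j \<le> z $ j"
  shows "z \<in> newton_polyhedron M"
proof -
  define v where "v = z - y"
  have "convex {y. y + v \<in> newton_polyhedron M}"
  proof -
    have "{y. y + v \<in> newton_polyhedron M} = (\<lambda>y. y + - v) ` newton_polyhedron M"
      by (force simp: image_iff algebra_simps)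
    then show ?thesis
      using convex_translation[OF convex_newton_polyhedron, of "- v" M] by (simp add: add.commute)
  qed
  moreover have "real_exponent \<alpha> + u + v \<in> newton_polyhedron M"
    if "\<alpha> \<in> supp M" "\<forall>j. 0 \<le> u $ j" for \<alpha> u
    using real_exponent_plus_in_newton_polyhedron[OF that(1), of "u + v"] that(2) assms(2)
    by (simp add: v_def add.assoc)
  ultimately have "newton_polyhedron M \<subseteq> {y. y + v \<in> newton_polyhedron M}"
    by (subst newton_polyhedron_def, intro hull_minimal) auto
  then show ?thesis using assms(1) by (auto simp: v_def)
qed

lemma newton_polyhedron_halfspace:
  assumes "\<And>\<alpha>. \<alpha> \<in> supp M \<Longrightarrow> b \<le> l \<bullet> real_exponent \<alpha>" "\<And>j. 0 \<le> l $ j"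
    and "y \<in> newton_polyhedron M"
  shows "b \<le> l \<bullet> y"
proof -
  have "0 \<le> l \<bullet> v" if "\<forall>j. 0 \<le> v $ j" for v
    unfolding inner_vec_def using that assms(2) by (intro sum_nonneg) auto
  then have "newton_polyhedron M \<subseteq> {y. b \<le> l \<bullet> y}"
    unfolding newton_polyhedron_def using assms(1) convex_halfspace_ge[of b l]
    by (intro hull_minimal) (force simp: inner_add_right)+
  then show ?thesis using assms(3) by auto
qed

lemma newton_polyhedron_mono:
  assumes "\<And>\<alpha>. \<alpha> \<in> supp M \<Longrightarrow> real_exponent \<alpha> \<in> newton_polyhedron N"
  shows "newton_polyhedron M \<subseteq> newton_polyhedron N"
  unfolding newton_polyhedron_def[of M]
  by (intro hull_minimal convex_newton_polyhedron)
    (use assms newton_polyhedron_upward_closed in fastforce)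

text \<open>Homogenisation: the Newton polyhedron is the slice at height \<open>1\<close> of the convex cone
  generated by the points \<open>(\<alpha>, 1)\<close> and the directions \<open>(e\<^sub>j, 0)\<close>.\<close>

lemma polyhedron_newton_polyhedron:
  fixes M :: "('n::finite exponent \<times> 'n exponent) set"
  assumes "finite M"
  shows "polyhedron (newton_polyhedron M)"
proof -
  define gens where "gens = (\<lambda>\<alpha>. (real_exponent \<alpha>, 1::real)) ` supp M
      \<union> (\<lambda>j. (axis j 1, 0)) ` (UNIV :: 'n set)"
  define C where "C = convex_cone hull gens"
  \<comment> \<open>An explicit candidate for the cone. The inclusion \<open>C \<subseteq> K\<close>
    lets a point of \<open>C\<close> at height 1 be read as a convex combination of exponents plus
    an orthant vector.\<close>
  define K where "K = {((\<Sum>\<alpha>\<in>supp M. c \<alpha> *\<^sub>R real_exponent \<alpha>) + v, \<Sum>\<alpha>\<in>supp M. c \<alpha>) |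
     c v. (\<forall>\<alpha>. 0 \<le> c \<alpha>) \<and> (\<forall>j. 0 \<le> v $ j)}"
  have finS: "finite (supp M)" using assms by (simp add: supp_def)
  have Ccone: "convex_cone C" unfolding C_def by (rule convex_cone_convex_cone_hull)
  have "convex_cone K"
    unfolding convex_cone_iff
  proof (intro conjI ballI allI impI)
    show "0 \<in> K" unfolding K_def
      by (rule CollectI, rule exI[of _ "\<lambda>_. 0"], rule exI[of _ 0]) (auto simp: zero_prod_def)
  next
    fix x y assume "x \<in> K" "y \<in> K"
    then obtain c v d u where
      "x = ((\<Sum>\<alpha>\<in>supp M. c \<alpha> *\<^sub>R real_exponent \<alpha>) + v, \<Sum>\<alpha>\<in>supp M. c \<alpha>)"
      "y = ((\<Sum>\<alpha>\<in>supp M. d \<alpha> *\<^sub>R real_exponent \<alpha>) + u, \<Sum>\<alpha>\<in>supp M. d \<alpha>)"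
      "\<forall>\<alpha>. 0 \<le> c \<alpha>" "\<forall>j. 0 \<le> v $ j" "\<forall>\<alpha>. 0 \<le> d \<alpha>" "\<forall>j. 0 \<le> u $ j"
      unfolding K_def by blast
    then show "x + y \<in> K" unfolding K_def
      by (intro CollectI exI[of _ "\<lambda>\<alpha>. c \<alpha> + d \<alpha>"] exI[of _ "v + u"])
        (auto simp: sum.distrib scaleR_add_left algebra_simps)
  next
    fix x and s :: real assume "x \<in> K" "0 \<le> s"
    then obtain c v where
      "x = ((\<Sum>\<alpha>\<in>supp M. c \<alpha> *\<^sub>R real_exponent \<alpha>) + v, \<Sum>\<alpha>\<in>supp M. c \<alpha>)"
      "\<forall>\<alpha>. 0 \<le> c \<alpha>" "\<forall>j. 0 \<le> v $ j"
      unfolding K_def by blast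
    then show "s *\<^sub>R x \<in> K" unfolding K_def using \<open>0 \<le> s\<close>
      by (intro CollectI exI[of _ "\<lambda>\<alpha>. s * c \<alpha>"] exI[of _ "s *\<^sub>R v"])
        (auto simp: scaleR_sum_right sum_distrib_left scaleR_add_right)
  qed
  moreover have "gens \<subseteq> K"
  proof
    fix x assume "x \<in> gens"
    then consider \<alpha> where "\<alpha> \<in> supp M" "x = (real_exponent \<alpha>, 1)"
      | j where "x = (axis j 1, 0)" unfolding gens_def by blast
    then show "x \<in> K"
    proof cases
      case (1 \<alpha>)
      have "(\<Sum>\<beta>\<in>supp M. (if \<beta> = \<alpha> then 1 else 0) *\<^sub>R real_exponent \<beta>) = real_exponent \<alpha>"
        "(\<Sum>\<beta>\<in>supp M. if \<beta> = \<alpha> then 1 else 0) = (1::real)"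
        using 1(1) finS by (simp_all add: if_distrib[of "\<lambda>c. c *\<^sub>R _"] cong: if_cong)
      then show ?thesis unfolding K_def 1(2)
        by (intro CollectI exI[of _ "\<lambda>\<beta>. if \<beta> = \<alpha> then 1 else 0"] exI[of _ 0]) auto
    next
      case (2 j)
      then show ?thesis unfolding K_def
        by (intro CollectI exI[of _ "\<lambda>\<beta>. 0"] exI[of _ "axis j 1"]) (auto simp: axis_def)
    qed
  qed
  ultimately have CK: "C \<subseteq> K" unfolding C_def by (intro hull_minimal)
  have slice: "newton_polyhedron M = {x. (x, 1) \<in> C}"
  proof
    have "convex {x. (x, 1) \<in> C}"
    proof -
      have "convex C" using Ccone by (simp add: convex_cone_def)
      show ?thesis
      proof (rule convexI)
        fix x y and u v :: real
        assume "x \<in> {x. (x, 1) \<in> C}" "y \<in> {x. (x, 1) \<in> C}" and uv: "0 \<le> u" "0 \<le> v" "u + v = 1"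
        then have "u *\<^sub>R (x, 1) + v *\<^sub>R (y, 1) \<in> C"
          using \<open>convex C\<close> by (intro convexD) auto
        then show "u *\<^sub>R x + v *\<^sub>R y \<in> {x. (x, 1) \<in> C}" using uv(3) by simp
      qed
    qed
    moreover have "(real_exponent \<alpha> + v, 1) \<in> C" if "\<alpha> \<in> supp M" "\<forall>j. 0 \<le> v $ j" for \<alpha> v
    proof -
      have *: "(v, 0) = (\<Sum>j\<in>UNIV. (v $ j) *\<^sub>R (axis j 1, 0::real))"
        by (simp add: sum_prod basis_expansion[of v, unfolded scalar_mult_eq_scaleR])
      have "(\<Sum>j\<in>J. (v $ j) *\<^sub>R (axis j 1, 0::real)) \<in> C" for J :: "'n set"
      proof (induction J rule: infinite_finite_induct)
        case (insert j J)
        have "(axis j 1, 0) \<in> C" unfolding C_def by (rule hull_inc) (auto simp: gens_def)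
        then have "v $ j *\<^sub>R (axis j 1, 0::real) \<in> C"
          using convex_cone_scaleR[OF Ccone] that(2) by blast
        then show ?case
          unfolding sum.insert[OF insert(1,2)] using insert(3) by (rule convex_cone_add[OF Ccone])
      qed (use convex_cone_contains_0[OF Ccone] in auto)
      then have "(v, 0) \<in> C" unfolding * .
      moreover have "(real_exponent \<alpha>, 1) \<in> C"
        unfolding C_def using that(1) by (intro hull_inc) (auto simp: gens_def)
      ultimately show ?thesis using convex_cone_add[OF Ccone] by fastforce
    qed
    ultimately show "newton_polyhedron M \<subseteq> {x. (x, 1) \<in> C}"
      unfolding newton_polyhedron_def by (intro hull_minimal) auto
    show "{x. (x, 1) \<in> C} \<subseteq> newton_polyhedron M"
    proof
      fix x assume "x \<in> {x. (x, 1) \<in> C}"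
      then have "(x, 1) \<in> K" using CK by auto
      then obtain c v where x: "x = (\<Sum>\<alpha>\<in>supp M. c \<alpha> *\<^sub>R real_exponent \<alpha>) + v"
        and c: "(\<Sum>\<alpha>\<in>supp M. c \<alpha>) = 1" "\<forall>\<alpha>. 0 \<le> c \<alpha>" and v: "\<forall>j. 0 \<le> v $ j"
        unfolding K_def by auto
      have "(\<Sum>\<alpha>\<in>supp M. c \<alpha> *\<^sub>R real_exponent \<alpha>) \<in> newton_polyhedron M"
        using c finS by (intro convex_sum convex_newton_polyhedron)
          (auto intro: real_exponent_in_newton_polyhedron)
      then show "x \<in> newton_polyhedron M"
        using v by (rule_tac newton_polyhedron_upward_closed) (auto simp: x)
    qed
  qed
  have "finite gens" using finS by (simp add: gens_def)
  then obtain H where H: "finite H" "C = \<Inter>H" "\<forall>h\<in>H. \<exists>a b. a \<noteq> 0 \<and> h = {x. a \<bullet> x \<le> b}"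
    using polyhedron_convex_cone_hull[of gens] unfolding polyhedron_def C_def by blast
  have "polyhedron {x::real^'n. (x, 1::real) \<in> h}" if "h \<in> H" for h
  proof -
    obtain a b where h: "h = {x. a \<bullet> x \<le> b}"
      using bspec[OF H(3) \<open>h \<in> H\<close>] by (elim exE conjE) (rule that)
    \<comment> \<open>\<open>fst a\<close> may be zero; the slice is then empty or the whole space,
      which \<open>polyhedron_halfspace_le\<close> also covers.\<close>
    have "{x. (x, 1::real) \<in> h} = {x. fst a \<bullet> x \<le> b - snd a}"
      by (auto simp: h inner_prod_def)
    then show ?thesis by (simp add: polyhedron_halfspace_le)
  qed
  then have "polyhedron (\<Inter>((\<lambda>h. {x. (x, 1::real) \<in> h}) ` H))"
    using H(1) by (intro polyhedron_Inter) auto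
  moreover have "newton_polyhedron M = \<Inter>((\<lambda>h. {x. (x, 1::real) \<in> h}) ` H)"
    unfolding slice H(2) by auto
  ultimately show ?thesis by simp
qed

lemma closed_newton_polyhedron: "finite M \<Longrightarrow> closed (newton_polyhedron M)"
  by (intro polyhedron_imp_closed polyhedron_newton_polyhedron)

text \<open>Extreme points of a hull belong to the generating set, and a nonzero orthant part
  \<open>v\<close> would put the point midway between \<alpha> and \<alpha> + 2v.\<close>

lemma extreme_point_newton_polyhedron:
  assumes "x extreme_point_of newton_polyhedron M"
  obtains \<alpha> where "\<alpha> \<in> supp M" "x = real_exponent \<alpha>"
proof -
  obtain \<alpha> v where *: "\<alpha> \<in> supp M" "x = real_exponent \<alpha> + v" "\<forall>j. 0 \<le> v $ j"
    using extreme_point_of_convex_hull assms unfolding newton_polyhedron_def by blast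
  have "v = 0"
  proof (rule ccontr)
    assume "v \<noteq> 0"
    have "real_exponent \<alpha> \<in> newton_polyhedron M" "real_exponent \<alpha> + 2 *\<^sub>R v \<in> newton_polyhedron M"
      using * by (auto intro!: real_exponent_in_newton_polyhedron
          real_exponent_plus_in_newton_polyhedron)
    moreover have "x \<in> open_segment (real_exponent \<alpha>) (real_exponent \<alpha> + 2 *\<^sub>R v)"
      using \<open>v \<noteq> 0\<close> by (auto simp: in_segment *(2) algebra_simps intro!: exI[of _ "1/2"])
    ultimately show False using assms unfolding extreme_point_of_def by blast
  qed
  with * that show thesis by simp
qed

lemma newton_vertices_subset_supp: "newton_vertices M \<subseteq> supp M"
proof
  fix \<alpha> assume "\<alpha> \<in> newton_vertices M"
  then obtain \<beta> where "\<beta> \<in> supp M" "real_exponent \<alpha> = real_exponent \<beta>"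
    unfolding newton_vertices_def using extreme_point_newton_polyhedron by blast
  then show "\<alpha> \<in> supp M"
    by (metis real_exponent_def of_nat_eq_iff vec_eq_iff vec_lambda_beta)
qed

lemma finite_newton_vertices: "finite M \<Longrightarrow> finite (newton_vertices M)"
  using newton_vertices_subset_supp[of M] by (auto simp: supp_def intro: finite_subset)

text \<open>A strictly positive functional has a compact face of minimisers, which has a vertex.\<close>

lemma newton_vertex_minimises:
  fixes M :: "('n::finite exponent \<times> 'n exponent) set"
  assumes "finite M" "M \<noteq> {}" "\<And>j. 0 < l $ j"
  obtains \<alpha> where "\<alpha> \<in> newton_vertices M"
    "\<And>y. y \<in> newton_polyhedron M \<Longrightarrow> l \<bullet> real_exponent \<alpha> \<le> l \<bullet> y"
proof -
  define B where "B = (\<lambda>\<alpha>. l \<bullet> real_exponent \<alpha>) ` supp M"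
  have B: "finite B" "B \<noteq> {}" using assms by (auto simp: B_def supp_def)
  define b where "b = Min B"
  have "b \<in> B" unfolding b_def using B by simp
  then obtain \<alpha>0 where \<alpha>0: "\<alpha>0 \<in> supp M" "l \<bullet> real_exponent \<alpha>0 = b"
    by (auto simp: B_def)
  have ge: "b \<le> l \<bullet> y" if "y \<in> newton_polyhedron M" for y
  proof (rule newton_polyhedron_halfspace[OF _ _ that])
    show "b \<le> l \<bullet> real_exponent \<alpha>" if "\<alpha> \<in> supp M" for \<alpha>
      unfolding b_def using B that by (intro Min_le) (auto simp: B_def)
  qed (use assms(3) less_imp_le in blast)
  define T where "T = newton_polyhedron M \<inter> {y. l \<bullet> y = b}"
  have face: "T face_of newton_polyhedron M"
    unfolding T_def by (intro face_of_Int_supporting_hyperplane_ge convex_newton_polyhedron ge)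
  have "bounded T"
  proof -
    \<comment> \<open>On the nonnegative orthant each term l_j y_j is at most the whole sum
      \<open>b\<close>, so strict positivity of \<open>l\<close> bounds the face.\<close>
    have "T \<subseteq> cbox 0 (\<chi> j. b / l $ j)"
    proof
      fix y assume y: "y \<in> T"
      have "y $ j \<le> b / l $ j" for j
      proof -
        have "l $ j * y $ j \<le> (\<Sum>i\<in>UNIV. l $ i * y $ i)"
          using assms(3) newton_polyhedron_nonneg[of y M] y
          by (intro member_le_sum) (auto simp: T_def less_imp_le)
        then show ?thesis using y assms(3)[of j]
          by (simp add: T_def inner_vec_def field_simps)
      qed
      then show "y \<in> cbox 0 (\<chi> j. b / l $ j)"
        using newton_polyhedron_nonneg[of y M] y by (auto simp: T_def mem_box_cart)
    qed
    then show ?thesis using bounded_cbox bounded_subset by blast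
  qed
  moreover have "closed T"
    unfolding T_def by (intro closed_Int closed_newton_polyhedron closed_hyperplane assms)
  ultimately have "compact T" using compact_eq_bounded_closed by blast
  moreover have "T \<noteq> {}"
    using \<alpha>0 real_exponent_in_newton_polyhedron by (auto simp: T_def)
  ultimately obtain x where x: "x extreme_point_of T"
    using extreme_point_exists_convex face face_of_imp_convex by blast
  then have "x extreme_point_of newton_polyhedron M" "x \<in> T"
    using extreme_point_of_face[OF face] by blast+
  moreover obtain \<alpha> where "x = real_exponent \<alpha>"
    using extreme_point_newton_polyhedron calculation(1) by blast
  ultimately show thesis
    using that[of \<alpha>] ge by (auto simp: newton_vertices_def T_def)
qed

text \<open>Suppose a hyperplane cuts off some exponent of \<open>M\<close> from the polyhedron of
  \<open>N\<close>. Its normal \<open>a\<close> is nonnegative, but zero entries could make the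
  minimising face unbounded; raising all entries by a small \<open>e\<close> yields a vertex of
  \<open>M\<close>, which is in the diagram but on the wrong side.\<close>

lemma newton_polyhedron_subset_if_diagram_subset:
  fixes M N :: "('n::finite exponent \<times> 'n exponent) set"
  assumes "finite M" "finite N" "newton_diagram M \<subseteq> newton_polyhedron N"
  shows "newton_polyhedron M \<subseteq> newton_polyhedron N"
proof (rule newton_polyhedron_mono, rule ccontr)
  fix \<alpha> assume \<alpha>: "\<alpha> \<in> supp M" "real_exponent \<alpha> \<notin> newton_polyhedron N"
  then have "M \<noteq> {}" by (auto simp: supp_def)
  show False
  proof (cases "N = {}")
    case True
    obtain \<beta> where \<beta>: "\<beta> \<in> newton_vertices M"
      using newton_vertex_minimises[OF assms(1) \<open>M \<noteq> {}\<close>, of "\<chi> j. 1"] by auto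
    have "real_exponent \<beta> \<in> newton_diagram M"
      using \<beta> by (auto simp: newton_diagram_def newton_vertices_def simp flip: face_of_singleton)
    then show False using assms(3) True by (auto simp: newton_polyhedron_def supp_def)
  next
    case False
    obtain a b where ab: "a \<bullet> real_exponent \<alpha> < b" "\<forall>x\<in>newton_polyhedron N. a \<bullet> x > b"
      using separating_hyperplane_closed_point[OF convex_newton_polyhedron
          closed_newton_polyhedron[OF assms(2)] \<alpha>(2)] by blast
    obtain \<beta> where \<beta>: "\<beta> \<in> supp N" using False by (auto simp: supp_def)
    have a: "0 \<le> a $ j" for j
    proof (rule ccontr)
      assume "\<not> 0 \<le> a $ j"
      \<comment> \<open>Moving by \<open>s\<close> along the axis lowers the functional by |b - a .
        \<beta>|, hence to at most \<open>b\<close>, against the strict separation.\<close>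
      define s where "s = \<bar>b - a \<bullet> real_exponent \<beta>\<bar> / (- a $ j)"
      have "real_exponent \<beta> + axis j s \<in> newton_polyhedron N"
        using \<beta> \<open>\<not> 0 \<le> a $ j\<close>
        by (intro real_exponent_plus_in_newton_polyhedron) (auto simp: s_def axis_def divide_nonneg_neg)
      then have "b < a \<bullet> real_exponent \<beta> + a $ j * s"
        using ab(2) by (force simp: inner_add_right inner_axis)
      then show False using \<open>\<not> 0 \<le> a $ j\<close> by (simp add: s_def)
    qed
    define d where "d = (\<Sum>j\<in>UNIV. real_exponent \<alpha> $ j)"
    have "0 \<le> d" unfolding d_def by (intro sum_nonneg) (simp add: real_exponent_def)
    \<comment> \<open>Small enough that \<open>e * d\<close>, the increase of the functional at
      \<alpha>, stays below the gap; \<open>d + 1\<close> avoids dividing by zero.\<close>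
    define e where "e = (b - a \<bullet> real_exponent \<alpha>) / (2 * (d + 1))"
    have "e > 0" unfolding e_def using ab(1) \<open>0 \<le> d\<close> by (intro divide_pos_pos) auto
    define l where "l = (\<chi> j. a $ j + e)"
    have l_inner: "l \<bullet> y = a \<bullet> y + e * (\<Sum>j\<in>UNIV. y $ j)" for y
      by (simp add: l_def inner_vec_def algebra_simps sum.distrib sum_distrib_left)
    have "e * d < b - a \<bullet> real_exponent \<alpha>"
    proof -
      have "(b - a \<bullet> real_exponent \<alpha>) * d < (b - a \<bullet> real_exponent \<alpha>) * (2 * (d + 1))"
        using ab(1) \<open>0 \<le> d\<close> by (intro mult_strict_left_mono) auto
      then show ?thesis using \<open>0 \<le> d\<close> by (simp add: e_def field_simps)
    qed
    then have lt: "l \<bullet> real_exponent \<alpha> < b" using l_inner by (simp add: d_def)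
    have "0 < l $ j" for j using a[of j] \<open>e > 0\<close> by (simp add: l_def)
    then obtain \<gamma> where \<gamma>: "\<gamma> \<in> newton_vertices M"
      "\<And>y. y \<in> newton_polyhedron M \<Longrightarrow> l \<bullet> real_exponent \<gamma> \<le> l \<bullet> y"
      using newton_vertex_minimises[OF assms(1) \<open>M \<noteq> {}\<close>, of l] by blast
    have "real_exponent \<gamma> \<in> newton_diagram M"
      using \<gamma>(1) by (auto simp: newton_diagram_def newton_vertices_def simp flip: face_of_singleton)
    then have *: "real_exponent \<gamma> \<in> newton_polyhedron N" using assms(3) by blast
    have "b < a \<bullet> real_exponent \<gamma>" using ab(2) * by blast
    also have "\<dots> \<le> l \<bullet> real_exponent \<gamma>"
      using \<open>e > 0\<close> by (auto simp: l_inner real_exponent_def intro!: mult_nonneg_nonneg sum_nonneg)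
    also have "\<dots> \<le> l \<bullet> real_exponent \<alpha>" using \<gamma>(2) real_exponent_in_newton_polyhedron \<alpha>(1) by blast
    finally show False using lt by simp
  qed
qed

lemma newton_diagram_subset: "newton_diagram M \<subseteq> newton_polyhedron M"
  using face_of_imp_subset by (fastforce simp: newton_diagram_def)

lemma newton_polyhedron_cong:
  assumes "finite M" "finite N" "newton_diagram M = newton_diagram N"
  shows "newton_polyhedron M = newton_polyhedron N"
  using newton_polyhedron_subset_if_diagram_subset assms newton_diagram_subset by (metis subset_antisym)

text \<open>The orthant at any exponent contains a unit ball. This makes the affine hull the whole
  space, so that facets have the dimension required by \<open>compact_facet\<close>.\<close>

lemma interior_newton_polyhedron:
  fixes M :: "('n::finite exponent \<times> 'n exponent) set"
  assumes "M \<noteq> {}"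
  shows "interior (newton_polyhedron M) \<noteq> {}"
proof -
  obtain \<alpha> where \<alpha>: "\<alpha> \<in> supp M" using assms by (auto simp: supp_def)
  define c where "c = real_exponent \<alpha> + (\<chi> j. 1)"
  have "ball c 1 \<subseteq> newton_polyhedron M"
  proof
    fix y assume "y \<in> ball c 1"
    then have "norm (c - y) < 1" by (simp add: dist_norm)
    have "real_exponent \<alpha> $ j \<le> y $ j" for j
      using component_le_norm_cart[of "c - y" j] \<open>norm (c - y) < 1\<close> by (simp add: c_def)
    then show "y \<in> newton_polyhedron M"
      using newton_polyhedron_upward_closed real_exponent_in_newton_polyhedron \<alpha> by blast
  qed
  then have "c \<in> interior (newton_polyhedron M)" by (simp add: mem_interior) (meson zero_less_one)
  then show ?thesis by blast
qed

text \<open>For a convenient Newton polyhedron, the facets that are not compact lie in the boundary of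
  the orthant, so the compact facets suffice to cut out the polyhedron.\<close>

lemma in_newton_polyhedron_if_weights:
  fixes M :: "('n::finite exponent \<times> 'n exponent) set"
  assumes "finite M" "M \<noteq> {}"
    and axes: "\<And>i. \<exists>s. axis i s \<in> newton_polyhedron M"
    and weight: "\<And>\<sigma>. compact_facet \<sigma> M \<Longrightarrow> associated_weight (w \<sigma>) \<sigma>"
    and nonneg: "\<And>j. 0 \<le> y $ j"
    and ge: "\<And>\<sigma>. compact_facet \<sigma> M \<Longrightarrow> fil (w \<sigma>) M \<le> ereal (w \<sigma> \<bullet> y)"
  shows "y \<in> newton_polyhedron M"
proof (rule ccontr)
  assume y: "y \<notin> newton_polyhedron M"
  let ?G = "newton_polyhedron M"
  have aff: "affine hull ?G = UNIV"
    using affine_hull_nonempty_interior interior_newton_polyhedron assms(2) by blast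
  \<comment> \<open>An irredundant family of half-spaces: each member then cuts out a facet.\<close>
  obtain H where H: "finite H" "?G = affine hull ?G \<inter> \<Inter>H"
    "\<forall>h\<in>H. \<exists>a b. a \<noteq> 0 \<and> h = {x. a \<bullet> x \<le> b}" "\<forall>H'. H' \<subset> H \<longrightarrow> ?G \<subset> affine hull ?G \<inter> \<Inter>H'"
    using polyhedron_newton_polyhedron[OF assms(1)] unfolding polyhedron_Int_affine_minimal by blast
  obtain A B where AB: "\<And>h. h \<in> H \<Longrightarrow> A h \<noteq> 0 \<and> h = {x. A h \<bullet> x \<le> B h}"
    using H(3) by metis
  obtain h where h: "h \<in> H" "y \<notin> h" using y H(2) aff by auto
  define a where "a = - A h"
  define b where "b = - B h"
  define \<sigma> where "\<sigma> = ?G \<inter> {x. A h \<bullet> x = B h}"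
  have "a \<noteq> 0" and hab: "h = {x. b \<le> a \<bullet> x}" using AB[OF h(1)] by (auto simp: a_def b_def)
  have \<sigma>ab: "\<sigma> \<subseteq> {x. a \<bullet> x = b}" by (auto simp: \<sigma>_def a_def b_def)
  have facet: "\<sigma> facet_of ?G"
    using facet_of_polyhedron_explicit[OF H(1,2), of A B] AB H(4) h(1) unfolding \<sigma>_def by blast
  have lt: "a \<bullet> y < b" using h(2) hab by auto
  have Gge: "b \<le> a \<bullet> x" if "x \<in> ?G" for x
    using that H(2) h(1) hab by blast
  obtain \<alpha> where \<alpha>: "\<alpha> \<in> supp M" using assms(2) by (auto simp: supp_def)
  have a: "0 \<le> a $ j" for j
  proof (rule ccontr)
    assume "\<not> 0 \<le> a $ j"
    \<comment> \<open>The \<open>+ 1\<close> is needed because the polyhedron is only known to lie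
      on the closed side \<open>b \<le> a \<bullet> x\<close>.\<close>
    define s where "s = (\<bar>b - a \<bullet> real_exponent \<alpha>\<bar> + 1) / (- a $ j)"
    have "real_exponent \<alpha> + axis j s \<in> ?G"
      using \<alpha> \<open>\<not> 0 \<le> a $ j\<close>
      by (intro real_exponent_plus_in_newton_polyhedron) (auto simp: s_def axis_def divide_nonneg_neg)
    then have "b \<le> a \<bullet> real_exponent \<alpha> + a $ j * s"
      using Gge by (force simp: inner_add_right inner_axis)
    then show False using \<open>\<not> 0 \<le> a $ j\<close> by (simp add: s_def)
  qed
  have ay: "0 \<le> a \<bullet> y" unfolding inner_vec_def using a nonneg by (intro sum_nonneg) auto
  show False
  \<comment> \<open>If the normal has a zero entry, the point of the polyhedron on that axis forces
    \<open>b \<le> 0\<close>; such an inequality holds on the whole orthant, so \<open>y\<close>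
    cannot violate it.\<close>
  proof (cases "\<exists>j. a $ j = 0")
    case True
    then obtain j s where "a $ j = 0" "axis j s \<in> ?G" using axes by blast
    then have "b \<le> 0" using Gge[of "axis j s"] by (simp add: inner_axis)
    then show False using ay lt by simp
  next
    case False
    then have apos: "0 < a $ j" for j using a[of j] by (metis less_eq_real_def)
    have "\<sigma> \<subseteq> cbox 0 (\<chi> j. b / a $ j)"
    proof
      fix x assume x: "x \<in> \<sigma>"
      have "x $ j \<le> b / a $ j" for j
      proof -
        have "a $ j * x $ j \<le> (\<Sum>i\<in>UNIV. a $ i * x $ i)"
          using a newton_polyhedron_nonneg[of x M] x
          by (intro member_le_sum) (auto simp: \<sigma>_def)
        then show ?thesis using x \<sigma>ab apos[of j]
          by (auto simp: inner_vec_def field_simps)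
      qed
      then show "x \<in> cbox 0 (\<chi> j. b / a $ j)"
        using newton_polyhedron_nonneg[of x M] x by (auto simp: \<sigma>_def mem_box_cart)
    qed
    then have "bounded \<sigma>" using bounded_cbox bounded_subset by blast
    moreover have "closed \<sigma>"
      unfolding \<sigma>_def by (intro closed_Int closed_newton_polyhedron closed_hyperplane assms)
    ultimately have "compact \<sigma>" using compact_eq_bounded_closed by blast
    have dim: "aff_dim ?G = int CARD('n)"
      using aff_dim_eq_full[of ?G] aff by simp
    have cf: "compact_facet \<sigma> M"
      using facet \<open>compact \<sigma>\<close> dim by (auto simp: compact_facet_def facet_of_def)
    have hull: "affine hull \<sigma> = {x. a \<bullet> x = b}"
    proof (rule affine_dim_equal)
      show "affine hull \<sigma> \<noteq> {}" using facet by (auto simp: facet_of_def)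
      show "affine hull \<sigma> \<subseteq> {x. a \<bullet> x = b}" using \<sigma>ab affine_hyperplane by (rule hull_minimal)
      show "aff_dim (affine hull \<sigma>) = aff_dim {x. a \<bullet> x = b}"
        using facet dim \<open>a \<noteq> 0\<close> by (simp add: facet_of_def)
    qed (auto intro: affine_hyperplane)
    define v where "v = w \<sigma>"
    have v: "v \<noteq> 0" "\<And>j. 0 \<le> v $ j"
      "\<And>x x'. a \<bullet> x = b \<Longrightarrow> a \<bullet> x' = b \<Longrightarrow> v \<bullet> (x - x') = 0"
      using weight[OF cf] hull by (auto simp: associated_weight_def v_def)
    obtain x0 where x0: "a \<bullet> x0 = b" using facet \<sigma>ab by (auto simp: facet_of_def)
    \<comment> \<open>\<open>u\<close> is the part of the weight \<open>v\<close> orthogonal to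
      \<open>a\<close>. It is a direction of the hyperplane, so \<open>v\<close> is orthogonal to it
      as well, and \<open>u\<close> vanishes.\<close>
    define c where "c = v \<bullet> a / (a \<bullet> a)"
    define u where "u = v - c *\<^sub>R a"
    have "a \<bullet> u = 0" using \<open>a \<noteq> 0\<close> by (simp add: u_def c_def inner_diff_right inner_commute)
    then have "v \<bullet> u = 0" using v(3)[of "x0 + u" x0] x0 by (simp add: inner_add_right)
    then have "u \<bullet> u = 0" using \<open>a \<bullet> u = 0\<close> by (simp add: u_def inner_diff_left)
    then have va: "v = c *\<^sub>R a" by (simp add: u_def)
    have "0 < c"
    proof -
      obtain j where "v $ j \<noteq> 0" using v(1) by (metis vec_eq_iff zero_index)
      then have "0 < v $ j" using v(2)[of j] by simp
      then show ?thesis using va apos[of j] by (simp add: zero_less_mult_iff)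
    qed
    have "ereal (c * b) \<le> fil v M"
      unfolding fil_def
    proof (rule INF_greatest, clarify)
      fix \<nu> \<mu> :: "(nat, 'n) vec" assume "(\<nu>, \<mu>) \<in> M"
      then have "\<nu> + \<mu> \<in> supp M" by (force simp: supp_def)
      then have "b \<le> a \<bullet> real_exponent (\<nu> + \<mu>)"
        using Gge real_exponent_in_newton_polyhedron by blast
      then have "c * b \<le> v \<bullet> real_exponent (\<nu> + \<mu>)"
        using \<open>0 < c\<close> by (simp add: va)
      then show "ereal (c * b) \<le> ereal (\<Sum>j\<in>UNIV. v $ j * real (\<nu> $ j + \<mu> $ j))"
        by (simp add: inner_vec_def real_exponent_def)
    qed
    also have "\<dots> \<le> ereal (v \<bullet> y)" unfolding v_def by (rule ge[OF cf])
    finally have "b \<le> a \<bullet> y" using \<open>0 < c\<close> by (simp add: va)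
    then show False using lt by simp
  qed
qed


section \<open>Monomials bounded by \<open>rho\<close>\<close>

definition monomial_norm :: "'n::finite exponent \<Rightarrow> complex ^ 'n \<Rightarrow> real" where
  "monomial_norm \<beta> x = (\<Prod>j\<in>UNIV. cmod (x $ j) ^ (\<beta> $ j))"

lemma monomial_norm_nonneg: "0 \<le> monomial_norm \<beta> x"
  by (simp add: monomial_norm_def prod_nonneg)

lemma monomial_norm_plus: "monomial_norm (\<alpha> + \<beta>) x = monomial_norm \<alpha> x * monomial_norm \<beta> x"
  by (simp add: monomial_norm_def power_add prod.distrib)

lemma rho_eq: "rho M x = (\<Sum>\<alpha>\<in>newton_vertices M. monomial_norm \<alpha> x)"
  by (simp add: rho_def monomial_norm_def)

lemma rho_nonneg: "0 \<le> rho M x"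
  by (simp add: rho_eq sum_nonneg monomial_norm_nonneg)

text \<open>Where no coordinate vanishes, the bound is linear in \<open>l = - ln |x|\<close>, which is minimised at
  a vertex; the other points are limits of such points.\<close>

lemma monomial_norm_le_rho_power:
  fixes M :: "('n::finite exponent \<times> 'n exponent) set"
  assumes "finite M" "M \<noteq> {}" "0 < k" "(1 / real k) *\<^sub>R real_exponent \<beta> \<in> newton_polyhedron M"
    and small: "\<And>j. cmod (x $ j) < 1"
  shows "monomial_norm \<beta> x \<le> rho M x ^ k"
proof -
  have nonzero: "monomial_norm \<beta> x \<le> rho M x ^ k"
    if x: "\<And>j. cmod (x $ j) < 1" "\<And>j. x $ j \<noteq> 0" for x :: "complex ^ 'n"
  proof -
    define l :: "real ^ 'n" where "l = (\<chi> j. - ln (cmod (x $ j)))"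
    have "0 < l $ j" for j using x by (simp add: l_def)
    then obtain \<alpha> where \<alpha>: "\<alpha> \<in> newton_vertices M"
      "\<And>y. y \<in> newton_polyhedron M \<Longrightarrow> l \<bullet> real_exponent \<alpha> \<le> l \<bullet> y"
      using newton_vertex_minimises[OF assms(1,2), of l] by blast
    have norm_exp: "monomial_norm \<gamma> x = exp (- (l \<bullet> real_exponent \<gamma>))" for \<gamma>
    proof -
      have "monomial_norm \<gamma> x = (\<Prod>j\<in>UNIV. exp (real (\<gamma> $ j) * ln (cmod (x $ j))))"
        unfolding monomial_norm_def using x(2)
        by (intro prod.cong refl) (simp add: exp_of_nat_mult)
      also have "\<dots> = exp (- (l \<bullet> real_exponent \<gamma>))"
        by (simp add: exp_sum[symmetric] inner_vec_def l_def real_exponent_def sum_negf mult.commute)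
      finally show ?thesis .
    qed
    have "k * (l \<bullet> real_exponent \<alpha>) \<le> l \<bullet> real_exponent \<beta>"
      using \<alpha>(2)[OF assms(4)] assms(3) by (simp add: field_simps)
    then have "monomial_norm \<beta> x \<le> monomial_norm \<alpha> x ^ k"
      unfolding norm_exp by (simp flip: exp_of_nat_mult)
    also have "\<dots> \<le> rho M x ^ k"
      unfolding rho_eq using \<alpha>(1) assms(1)
      by (intro power_mono member_le_sum monomial_norm_nonneg finite_newton_vertices)
    finally show ?thesis .
  qed
  \<comment> \<open>Only the vanishing coordinates are moved, and for 0 < e < 1 all moduli stay
    below 1.\<close>
  define X :: "real \<Rightarrow> complex ^ 'n" where
    "X e = (\<chi> j. if x $ j = 0 then of_real e else x $ j)" for e
  have X0: "X 0 = x" by (simp add: X_def vec_eq_iff)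
  have lim: "((\<lambda>e. monomial_norm \<gamma> (X e)) \<longlongrightarrow> monomial_norm \<gamma> x) (at_right 0)" for \<gamma>
  proof -
    have "((\<lambda>e. X e $ j) \<longlongrightarrow> X 0 $ j) (at_right 0)" for j
      by (cases "x $ j = 0") (auto simp: X_def intro!: tendsto_eq_intros)
    from vec_tendstoI[OF this] show ?thesis unfolding monomial_norm_def X0
      by (intro tendsto_intros)
  qed
  have "((\<lambda>e. rho M (X e) ^ k) \<longlongrightarrow> rho M x ^ k) (at_right 0)"
    unfolding rho_eq by (intro tendsto_intros lim)
  moreover have "\<forall>\<^sub>F e in at_right 0. monomial_norm \<beta> (X e) \<le> rho M (X e) ^ k"
    by (rule eventually_at_rightI[of _ 1]) (use small in \<open>auto intro!: nonzero simp: X_def split: if_splits\<close>)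
  ultimately show ?thesis
    using lim tendsto_le[OF trivial_limit_at_right_real] by blast
qed

text \<open>The given point on each axis stays in the polyhedron when rounded up to an integer, so a
  power of |x_i| lies below \<open>rho\<close>, where x_i is a nonzero coordinate.\<close>

lemma rho_pos:
  fixes M :: "('n::finite exponent \<times> 'n exponent) set"
  assumes "finite M" "M \<noteq> {}" "\<And>i. \<exists>s. axis i s \<in> newton_polyhedron M"
    and "x \<noteq> 0" "\<And>j. cmod (x $ j) < 1"
  shows "0 < rho M x"
proof -
  obtain i where i: "x $ i \<noteq> 0" using assms(4) by (metis vec_eq_iff zero_index)
  obtain s where s: "axis i s \<in> newton_polyhedron M" using assms(3) by blast
  define N where "N = nat \<lceil>s\<rceil>"
  have "real_exponent (axis i N) \<in> newton_polyhedron M"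
    by (rule newton_polyhedron_upward_closed[OF s]) (auto simp: real_exponent_def axis_def N_def real_nat_ceiling_ge)
  then have "monomial_norm (axis i N) x \<le> rho M x"
    using monomial_norm_le_rho_power[of M 1 "axis i N" x] assms by simp
  moreover have "monomial_norm (axis i N) x = cmod (x $ i) ^ N"
  proof -
    have "monomial_norm (axis i N) x = (\<Prod>j\<in>UNIV. if j = i then cmod (x $ i) ^ N else 1)"
      unfolding monomial_norm_def by (intro prod.cong) (auto simp: axis_def)
    then show ?thesis by simp
  qed
  ultimately show ?thesis using i by (metis zero_less_norm_iff zero_less_power less_le_trans)
qed


section \<open>Derivatives of mixed polynomials\<close>

definition mixed_monomial :: "('n::finite exponent \<times> 'n exponent) \<Rightarrow> complex ^ 'n \<Rightarrow> complex" where
  "mixed_monomial k x = (\<Prod>j\<in>UNIV. (x $ j) ^ (fst k $ j) * cnj (x $ j) ^ (snd k $ j))"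

lemma norm_mixed_monomial: "cmod (mixed_monomial k x) = monomial_norm (fst k + snd k) x"
  by (simp add: mixed_monomial_def monomial_norm_def norm_mult norm_power power_add
      flip: prod_norm)

lemma mixed_monomial_plus: "mixed_monomial (k + l) x = mixed_monomial k x * mixed_monomial l x"
  by (simp add: mixed_monomial_def power_add prod.distrib[symmetric] algebra_simps)

lemma mixed_eval_superset:
  assumes "finite A" "Poly_Mapping.keys p \<subseteq> A"
  shows "mixed_eval p x = (\<Sum>k\<in>A. Poly_Mapping.lookup p k * mixed_monomial k x)"
proof -
  have "mixed_eval p x = (\<Sum>k\<in>Poly_Mapping.keys p. Poly_Mapping.lookup p k * mixed_monomial k x)"
    unfolding mixed_eval_def by (intro sum.cong) (auto simp: mixed_monomial_def)
  also have "\<dots> = (\<Sum>k\<in>A. Poly_Mapping.lookup p k * mixed_monomial k x)"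
    by (intro sum.mono_neutral_left assms) (auto simp: in_keys_iff)
  finally show ?thesis .
qed

lemma mixed_eval_eq:
  "mixed_eval p x = (\<Sum>k\<in>Poly_Mapping.keys p. Poly_Mapping.lookup p k * mixed_monomial k x)"
  by (rule mixed_eval_superset) auto

text \<open>Subtraction of naturals truncates: for \<open>\<beta> $ i = 0\<close> the exponent on
  the left is \<beta> itself. Derivative bounds carry the factor \<open>\<beta> $ i\<close>, which
  removes that case.\<close>

lemma monomial_norm_diff_axis:
  "monomial_norm (\<beta> - axis i 1) x
    = cmod (x $ i) ^ (\<beta> $ i - 1) * (\<Prod>j\<in>UNIV - {i}. cmod (x $ j) ^ (\<beta> $ j))"
  unfolding monomial_norm_def
  by (subst prod.remove[of _ i]) (auto intro!: prod.cong simp: axis_def)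

text \<open>The modulus does not distinguish x_j from its conjugate, so the bound on the real
  derivative depends only on the total exponent \<beta>. The last clause serves to identify the
  derivative of a holomorphic polynomial with its complex partial derivatives.\<close>

lemma has_derivative_mixed_monomial:
  fixes k :: "'n::finite exponent \<times> 'n exponent"
  defines "\<beta> \<equiv> fst k + snd k"
  obtains D where "(mixed_monomial k has_derivative D) (at x)"
    "\<And>u. cmod (D u) \<le> (\<Sum>j\<in>UNIV. real (\<beta> $ j) * monomial_norm (\<beta> - axis j 1) x) * norm u"
    "snd k = 0 \<Longrightarrow> \<forall>c u. D (c *s u) = c * D u"
proof -
  define f where "f i x = (x $ i) ^ (fst k $ i) * cnj (x $ i) ^ (snd k $ i)"
    for i and x :: "complex ^ 'n"
  define f' where "f' i u = (x $ i) ^ (fst k $ i) * (of_nat (snd k $ i) * cnj (u $ i) * cnj (x $ i) ^ (snd k $ i - 1))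
     + of_nat (fst k $ i) * u $ i * (x $ i) ^ (fst k $ i - 1) * cnj (x $ i) ^ (snd k $ i)"
    for i and u :: "complex ^ 'n"
  define D where "D u = (\<Sum>i\<in>UNIV. f' i u * (\<Prod>j\<in>UNIV - {i}. f j x))" for u
  have nth: "((\<lambda>x. x $ i) has_derivative (\<lambda>u. u $ i)) (at x)" for i and x :: "complex ^ 'n"
    by (rule bounded_linear_imp_has_derivative[OF bounded_linear_vec_nth])
  have "(f i has_derivative f' i) (at x)" for i
    unfolding f_def[abs_def] f'_def[abs_def]
    by (intro has_derivative_mult has_derivative_power nth
        bounded_linear.has_derivative[OF bounded_linear_cnj nth])
  then have "((\<lambda>x. \<Prod>i\<in>UNIV. f i x) has_derivative D) (at x)"
    unfolding D_def[abs_def] by (intro has_derivative_prod)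
  then have 1: "(mixed_monomial k has_derivative D) (at x)"
    by (simp add: mixed_monomial_def[abs_def] f_def)
  have f'_le: "cmod (f' i u) \<le> real (\<beta> $ i) * cmod (x $ i) ^ (\<beta> $ i - 1) * norm u" for i u
  proof -
    define r where "r = cmod (x $ i)"
    have "cmod (f' i u) \<le> r ^ (fst k $ i) * (real (snd k $ i) * cmod (u $ i) * r ^ (snd k $ i - 1))
        + real (fst k $ i) * cmod (u $ i) * r ^ (fst k $ i - 1) * r ^ (snd k $ i)"
      unfolding f'_def r_def by (rule order_trans[OF norm_triangle_ineq]) (simp add: norm_mult norm_power)
    \<comment> \<open>For a zero exponent the truncated \<open>- 1\<close> would break the power
      law, but the factor in front vanishes.\<close>
    also have "r ^ (fst k $ i) * (real (snd k $ i) * cmod (u $ i) * r ^ (snd k $ i - 1))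
        = real (snd k $ i) * r ^ (\<beta> $ i - 1) * cmod (u $ i)"
      by (cases "snd k $ i") (auto simp: \<beta>_def power_add algebra_simps)
    also have "real (fst k $ i) * cmod (u $ i) * r ^ (fst k $ i - 1) * r ^ (snd k $ i)
        = real (fst k $ i) * r ^ (\<beta> $ i - 1) * cmod (u $ i)"
      by (cases "fst k $ i") (auto simp: \<beta>_def power_add algebra_simps)
    also have "real (snd k $ i) * r ^ (\<beta> $ i - 1) * cmod (u $ i) +
        real (fst k $ i) * r ^ (\<beta> $ i - 1) * cmod (u $ i)
        = real (\<beta> $ i) * r ^ (\<beta> $ i - 1) * cmod (u $ i)"
      by (simp add: \<beta>_def algebra_simps)
    also have "\<dots> \<le> real (\<beta> $ i) * r ^ (\<beta> $ i - 1) * norm u"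
      by (intro mult_left_mono Finite_Cartesian_Product.norm_nth_le) (simp add: r_def)
    finally show ?thesis by (simp add: r_def)
  qed
  have 2: "cmod (D u) \<le> (\<Sum>j\<in>UNIV. real (\<beta> $ j) * monomial_norm (\<beta> - axis j 1) x) * norm u" for u
    unfolding D_def sum_distrib_right
  proof (intro sum_norm_le)
    fix i
    have "cmod (\<Prod>j\<in>UNIV - {i}. f j x) = (\<Prod>j\<in>UNIV - {i}. cmod (x $ j) ^ (\<beta> $ j))"
      by (simp add: f_def \<beta>_def norm_mult norm_power power_add flip: prod_norm)
    then have "cmod (f' i u * (\<Prod>j\<in>UNIV - {i}. f j x))
        \<le> (real (\<beta> $ i) * cmod (x $ i) ^ (\<beta> $ i - 1) * norm u) *
          (\<Prod>j\<in>UNIV - {i}. cmod (x $ j) ^ (\<beta> $ j))"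
      unfolding norm_mult by (intro mult_mono f'_le) (auto intro!: prod_nonneg)
    then show "cmod (f' i u * (\<Prod>j\<in>UNIV - {i}. f j x))
        \<le> real (\<beta> $ i) * monomial_norm (\<beta> - axis i 1) x * norm u"
      unfolding monomial_norm_diff_axis by (simp add: algebra_simps)
  qed
  have 3: "\<forall>c u. D (c *s u) = c * D u" if "snd k = 0"
    using that by (simp add: D_def f'_def sum_distrib_left algebra_simps)
  show thesis using 1 2 3 that by blast
qed

text \<open>Links the complex partial derivatives to the real chain rule along curves: without
  conjugates the real derivative is complex linear, hence fixed by its values on the unit
  vectors.\<close>

lemma has_derivative_mixed_eval_ordinary:
  fixes p :: "'n::finite mixed_poly"
  assumes "ordinary_poly p"
  shows "(mixed_eval p has_derivative (\<lambda>u. \<Sum>i\<in>UNIV. partial_deriv i (mixed_eval p) x * u $ i)) (at x)"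
proof -
  have "\<exists>D. (mixed_monomial k has_derivative D) (at x) \<and> (snd k = 0 \<longrightarrow> (\<forall>c u. D (c *s u) = c * D u))"
    for k :: "'n exponent \<times> 'n exponent"
    using has_derivative_mixed_monomial[of k x] by metis
  then obtain D where D: "\<And>k. (mixed_monomial k has_derivative D k) (at x)"
    "\<And>k c u. snd k = 0 \<Longrightarrow> D k (c *s u) = c * D k u" by metis
  define E where "E u = (\<Sum>k\<in>Poly_Mapping.keys p. Poly_Mapping.lookup p k * D k u)" for u
  have E: "(mixed_eval p has_derivative E) (at x)"
    unfolding mixed_eval_eq[abs_def] E_def[abs_def]
    by (intro has_derivative_sum has_derivative_mult_right D)
  have E_scale: "E (c *s u) = c * E u" for c u
    unfolding E_def sum_distrib_left
    by (intro sum.cong refl) (use assms D(2) in \<open>auto simp: ordinary_poly_def\<close>)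
  have partial: "partial_deriv i (mixed_eval p) x = E (axis i 1)" for i
  proof -
    define l :: "complex \<Rightarrow> complex ^ 'n" where "l z = (\<chi> j. if j = i then z else x $ j)" for z
    have l: "l (x $ i) = x" by (simp add: l_def vec_eq_iff)
    have "linear (\<lambda>z::complex. z *s (axis i 1 :: complex ^ 'n))"
      by (rule linearI) (auto simp: vec_eq_iff algebra_simps)
    then have "((\<lambda>z. (x - x $ i *s axis i 1) + z *s axis i 1) has_derivative (\<lambda>z. z *s axis i 1)) (at (x $ i))"
      by (auto simp: linear_conv_bounded_linear intro!: derivative_eq_intros
          bounded_linear_imp_has_derivative)
    moreover have "(\<lambda>z. (x - x $ i *s axis i 1) + z *s axis i 1) = l"
      by (simp add: l_def fun_eq_iff vec_eq_iff axis_def)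
    ultimately have "(l has_derivative (\<lambda>z. z *s axis i 1)) (at (x $ i))" by simp
    then have "((\<lambda>z. mixed_eval p (l z)) has_derivative (\<lambda>z. E (z *s axis i 1))) (at (x $ i))"
      using has_derivative_compose[of l _ "x $ i" UNIV "mixed_eval p" E] E by (simp add: l)
    then have "((\<lambda>z. mixed_eval p (l z)) has_field_derivative E (axis i 1)) (at (x $ i))"
      by (simp add: has_field_derivative_def E_scale mult.commute[of _ "E _"])
    then show ?thesis unfolding partial_deriv_def l_def by (rule DERIV_imp_deriv)
  qed
  have "E u = (\<Sum>i\<in>UNIV. partial_deriv i (mixed_eval p) x * u $ i)" for u
  proof -
    have "linear E" using E by (rule has_derivative_linear)
    have "E u = E (\<Sum>i\<in>UNIV. u $ i *s axis i 1)" by (simp add: basis_expansion)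
    also have "\<dots> = (\<Sum>i\<in>UNIV. E (u $ i *s axis i 1))" using \<open>linear E\<close> by (rule linear_sum)
    finally show ?thesis by (simp add: E_scale partial mult.commute)
  qed
  then have "E = (\<lambda>u. \<Sum>i\<in>UNIV. partial_deriv i (mixed_eval p) x * u $ i)" by (rule ext)
  then show ?thesis using E by simp
qed

text \<open>A segment through the origin is no obstacle: there \<open>norm (x - y) = norm x + norm y\<close>.\<close>

lemma norm_diff_bound_off_zero:
  fixes f :: "'a::euclidean_space \<Rightarrow> 'b::real_normed_vector"
  assumes "convex S" "0 \<le> B"
    and deriv: "\<And>x. x \<in> S \<Longrightarrow> x \<noteq> 0 \<Longrightarrow> \<exists>D. (f has_derivative D) (at x) \<and> (\<forall>u. norm (D u) \<le> B * norm u)"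
    and bound: "\<And>x. x \<in> S \<Longrightarrow> norm (f x) \<le> B * norm x"
    and xy: "x \<in> S" "y \<in> S"
  shows "norm (f x - f y) \<le> B * norm (x - y)"
proof (cases "0 \<in> closed_segment x y")
  case True
  then have "dist x y = dist x 0 + dist 0 y" using between between_mem_segment by blast
  then have *: "norm (x - y) = norm x + norm y" by (simp add: dist_norm)
  have "norm (f x - f y) \<le> norm (f x) + norm (f y)" by (rule norm_triangle_ineq4)
  also have "\<dots> \<le> B * norm x + B * norm y" using bound xy by (simp add: add_mono)
  finally show ?thesis by (simp add: * distrib_left)
next
  case False
  have seg: "closed_segment x y \<subseteq> S" using assms(1) xy by (simp add: closed_segment_subset)
  have "\<forall>z\<in>closed_segment x y. \<exists>D. (f has_derivative D) (at z) \<and> (\<forall>u. norm (D u) \<le> B * norm u)"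
    using deriv seg False by blast
  then obtain D where D: "\<And>z. z \<in> closed_segment x y \<Longrightarrow> (f has_derivative D z) (at z)"
    "\<And>z u. z \<in> closed_segment x y \<Longrightarrow> norm (D z u) \<le> B * norm u" by metis
  show ?thesis
  proof (rule differentiable_bound[of "closed_segment x y" f D])
    show "onorm (D z) \<le> B" if "z \<in> closed_segment x y" for z
      using D(2)[OF that] assms(2) by (intro onorm_bound)
  qed (auto intro: D has_derivative_at_withinI)
qed


section \<open>Quotients by a control function\<close>

lemma fil_finite:
  assumes "finite M" "M \<noteq> {}"
  obtains r where "fil w M = ereal r"
proof -
  have "fil w M \<in> (\<lambda>(\<nu>, \<mu>). ereal (\<Sum>j\<in>UNIV. w $ j * real (\<nu> $ j + \<mu> $ j))) ` M"
    unfolding fil_def using assms by (simp add: cInf_eq_Min)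
  with that show thesis by auto
qed

lemma fil_le: "k \<in> M \<Longrightarrow> fil w M \<le> ereal (w \<bullet> real_exponent (fst k + snd k))"
  unfolding fil_def by (rule INF_lower2[of k]) (auto simp: real_exponent_def inner_vec_def case_prod_beta)

lemma real_exponent_diff_axis:
  "1 \<le> \<beta> $ j \<Longrightarrow> real_exponent (\<beta> - axis j 1) = real_exponent \<beta> - axis j 1"
  by (auto simp: real_exponent_def vec_eq_iff axis_def)

lemma weight_le_max_weight: "v $ j \<le> max_weight v"
  by (simp add: max_weight_def)

text \<open>\<open>M\<close> will be the set of monomials of the whole family \<open>h\<close>, not
  of a single member, so that the estimates share one \<open>M\<close> for all parameters.\<close>

locale convenient_newton =
  fixes M :: "('n::finite exponent \<times> 'n exponent) set"
    and w :: "(real ^ 'n) set \<Rightarrow> real ^ 'n"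
  assumes finite: "finite M" and nonempty: "M \<noteq> {}"
    and axes: "\<And>i. \<exists>s. axis i s \<in> newton_polyhedron M"
    and weight: "\<And>\<sigma>. compact_facet \<sigma> M \<Longrightarrow> associated_weight (w \<sigma>) \<sigma>"
begin

text \<open>The condition on the monomials of \<open>g P\<^sub>i\<close>: differentiating such a monomial lowers its
  filtration by at most the maximal weight, so the derivative is still bounded by \<open>rho\<close>.\<close>

definition dominated :: "'n exponent \<Rightarrow> bool" where
  "dominated \<beta> \<longleftrightarrow> (\<forall>\<sigma>. compact_facet \<sigma> M \<longrightarrow>
     fil (w \<sigma>) M + ereal (max_weight (w \<sigma>)) \<le> ereal (w \<sigma> \<bullet> real_exponent \<beta>))"

lemma monomial_norm_le_rho:
  assumes "k \<in> M" "\<And>j. cmod (x $ j) < 1"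
  shows "monomial_norm (fst k + snd k) x \<le> rho M x"
proof -
  have "fst k + snd k \<in> supp M" using assms(1) by (force simp: supp_def)
  with monomial_norm_le_rho_power[OF finite nonempty, of 1 "fst k + snd k" x] assms(2)
  show ?thesis using
      real_exponent_in_newton_polyhedron[of "fst k + snd k" M] by simp
qed

lemma dominated_diff_axis_le_rho:
  assumes "dominated \<beta>" "1 \<le> \<beta> $ j" "\<And>j. cmod (x $ j) < 1"
  shows "monomial_norm (\<beta> - axis j 1) x \<le> rho M x"
proof -
  have "real_exponent (\<beta> - axis j 1) \<in> newton_polyhedron M"
  proof (rule in_newton_polyhedron_if_weights[OF finite nonempty axes weight])
    fix \<sigma> assume \<sigma>: "compact_facet \<sigma> M"
    obtain r where r: "fil (w \<sigma>) M = ereal r" using fil_finite[OF finite nonempty] .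
    have "r + max_weight (w \<sigma>) \<le> w \<sigma> \<bullet> real_exponent \<beta>"
      using assms(1) \<sigma> r by (auto simp: dominated_def)
    then show "fil (w \<sigma>) M \<le> ereal (w \<sigma> \<bullet> real_exponent (\<beta> - axis j 1))"
      unfolding real_exponent_diff_axis[OF assms(2)] using weight_le_max_weight[of "w \<sigma>" j]
      by (simp add: r inner_diff_right inner_axis)
  qed (auto simp: real_exponent_def)
  then show ?thesis
    using monomial_norm_le_rho_power[OF finite nonempty, of 1 "\<beta> - axis j 1" x] assms(3) by simp
qed

text \<open>An exponent of \<open>h\<close> may satisfy the facet inequalities without margin, so
  its derivative alone can escape \<open>rho\<close>. The margin of one maximal weight in \<beta>
  absorbs the loss: the total weight is at least twice the filtration, whence the halved exponent
  and the square.\<close>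

lemma dominated_times_diff_axis_le_rho:
  assumes "dominated \<beta>" "k \<in> M" "1 \<le> (fst k + snd k) $ j" "\<And>j. cmod (x $ j) < 1"
  shows "monomial_norm \<beta> x * monomial_norm (fst k + snd k - axis j 1) x \<le> (rho M x)\<^sup>2"
proof -
  define \<alpha> where "\<alpha> = fst k + snd k"
  have plus: "real_exponent (\<beta> + (\<alpha> - axis j 1)) = real_exponent \<beta> + real_exponent \<alpha> - axis j 1"
    using real_exponent_diff_axis[OF assms(3)] by (simp add: \<alpha>_def real_exponent_def vec_eq_iff)
  have "(1 / real 2) *\<^sub>R real_exponent (\<beta> + (\<alpha> - axis j 1)) \<in> newton_polyhedron M"
  proof (rule in_newton_polyhedron_if_weights[OF finite nonempty axes weight])
    fix \<sigma> assume \<sigma>: "compact_facet \<sigma> M"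
    obtain r where r: "fil (w \<sigma>) M = ereal r" using fil_finite[OF finite nonempty] .
    have "r + max_weight (w \<sigma>) \<le> w \<sigma> \<bullet> real_exponent \<beta>"
      using assms(1) \<sigma> r by (auto simp: dominated_def)
    moreover have "r \<le> w \<sigma> \<bullet> real_exponent \<alpha>"
      using fil_le[OF assms(2), of "w \<sigma>"] r by (simp add: \<alpha>_def)
    ultimately show "fil (w \<sigma>) M \<le> ereal (w \<sigma> \<bullet> (1 / real 2) *\<^sub>R real_exponent (\<beta> + (\<alpha> - axis j 1)))"
      unfolding plus using weight_le_max_weight[of "w \<sigma>" j]
      by (simp add: r inner_add_right inner_diff_right inner_axis)
  qed (auto simp: real_exponent_def)
  then show ?thesis
    using monomial_norm_le_rho_power[OF finite nonempty, of 2 "\<beta> + (\<alpha> - axis j 1)" x] assms(4)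
    by (simp add: monomial_norm_plus \<alpha>_def)
qed

text \<open>One factor |x_j| is split off and bounded by the norm; the rest is a derivative
  exponent. This gives the linear decay at the origin required by
  \<open>norm_diff_bound_off_zero\<close>.\<close>

lemma dominated_le_norm_rho:
  assumes "dominated \<beta>" "\<beta> \<noteq> 0" "\<And>j. cmod (x $ j) < 1"
  shows "monomial_norm \<beta> x \<le> norm x * rho M x"
proof -
  obtain j where j: "1 \<le> \<beta> $ j" using assms(2)
    by (metis vec_eq_iff zero_index less_one not_le)
  have "monomial_norm \<beta> x = cmod (x $ j) * monomial_norm (\<beta> - axis j 1) x"
    unfolding monomial_norm_diff_axis unfolding monomial_norm_def using j
    by (subst prod.remove[of _ j]) (auto simp: power_eq_if)
  also have "\<dots> \<le> norm x * rho M x"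
    by (intro mult_mono dominated_diff_axis_le_rho assms j monomial_norm_nonneg
        Finite_Cartesian_Product.norm_nth_le norm_ge_zero)
  finally show ?thesis .
qed

lemma rho_zero_off_origin: "x \<noteq> 0 \<Longrightarrow> (\<And>j. cmod (x $ j) < 1) \<Longrightarrow> 0 < rho M x"
  using rho_pos finite nonempty axes by blast

text \<open>With R = \<open>rho M z\<close> and h = |H(z)|, the numerator of the quotient rule is at
  most (E1 R h + E2 R^2) |u|, and R <= c h cancels h^2, leaving c E1 + c^2 E2. The extra summand c
  of \<open>L\<close> covers the bound c |z| on the quotient itself. The coefficients enter only
  through their bound \<open>C\<close>, which makes \<open>L\<close> uniform in a parameter.\<close>

lemma quotient_lipschitz:
  fixes a :: "('n exponent \<times> 'n exponent) \<Rightarrow> complex"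
  defines "H \<equiv> \<lambda>x. \<Sum>k\<in>M. a k * mixed_monomial k x"
  assumes coeff: "\<And>k. k \<in> M \<Longrightarrow> cmod (a k) \<le> C"
    and \<kappa>: "dominated (fst \<kappa> + snd \<kappa>)" "fst \<kappa> + snd \<kappa> \<noteq> 0"
    and c: "0 \<le> c" and r: "r \<le> 1"
    and low: "\<And>x. norm x < r \<Longrightarrow> rho M x \<le> c * cmod (H x)"
    and xy: "norm x < r" "norm y < r"
    and L: "L = c + c * (\<Sum>j\<in>UNIV. real ((fst \<kappa> + snd \<kappa>) $ j))
      + c\<^sup>2 * (\<Sum>k\<in>M. C * (\<Sum>j\<in>UNIV. real ((fst k + snd k) $ j)))"
  shows "cmod (mixed_monomial \<kappa> x / H x - mixed_monomial \<kappa> y / H y) \<le> L * norm (x - y)"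
proof -
  define \<beta> where "\<beta> = fst \<kappa> + snd \<kappa>"
  define E1 where "E1 = (\<Sum>j\<in>UNIV. real (\<beta> $ j))"
  define E2 where "E2 = (\<Sum>k\<in>M. C * (\<Sum>j\<in>UNIV. real ((fst k + snd k) $ j)))"
  obtain k0 where "k0 \<in> M" using nonempty by blast
  then have C0: "0 \<le> C" using coeff norm_ge_zero order_trans by blast
  have E0: "0 \<le> E1" "0 \<le> E2" unfolding E1_def E2_def
    using C0 by (auto intro!: sum_nonneg mult_nonneg_nonneg)
  have small: "cmod (z $ j) < 1" if "norm z < r" for z :: "complex ^ 'n" and j
    using that r Finite_Cartesian_Product.norm_nth_le[of z j] by linarith
  have H_pos: "0 < cmod (H z)" if "norm z < r" "z \<noteq> 0" for z
    using rho_zero_off_origin[OF that(2)] small[OF that(1)] low[OF that(1)] c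
    by (metis less_le_trans mult_zero_right norm_zero zero_less_norm_iff less_irrefl)
  show ?thesis
  proof (rule norm_diff_bound_off_zero[of "{z. norm z < r}"])
    have "{z::complex ^ 'n. norm z < r} = ball 0 r" by (auto simp: dist_norm)
    then show "convex {z::complex ^ 'n. norm z < r}" by simp
    show "0 \<le> L" using c E0 by (simp add: L E1_def E2_def \<beta>_def)
    show "x \<in> {z. norm z < r}" "y \<in> {z. norm z < r}" using xy by auto
  next
    fix z :: "complex ^ 'n" assume "z \<in> {z. norm z < r}"
    then have z: "norm z < r" by simp
    have m: "cmod (mixed_monomial \<kappa> z) \<le> norm z * rho M z"
      unfolding norm_mixed_monomial by (rule dominated_le_norm_rho[OF \<kappa>]) (use small z in auto)
    show "cmod (mixed_monomial \<kappa> z / H z) \<le> L * norm z"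
    proof (cases "z = 0")
      \<comment> \<open>Here \<open>m\<close> forces the monomial to vanish, so the quotient is 0
        whatever \<open>H\<close> is at the origin.\<close>
      case True
      then show ?thesis using m by simp
    next
      case False
      have "cmod (mixed_monomial \<kappa> z) \<le> norm z * (c * cmod (H z))"
        using m low[OF z] mult_left_mono[OF _ norm_ge_zero] order_trans by blast
      then have "cmod (mixed_monomial \<kappa> z / H z) \<le> c * norm z"
        using H_pos[OF z False] by (simp add: norm_divide divide_simps mult.commute mult.left_commute)
      also have "\<dots> \<le> L * norm z"
        using c E0 by (intro mult_right_mono) (auto simp: L E1_def E2_def \<beta>_def)
      finally show ?thesis .
    qed
  next
    fix z :: "complex ^ 'n" assume "z \<in> {z. norm z < r}" and z0: "z \<noteq> 0"
    then have z: "norm z < r" by simp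
    define h where "h = cmod (H z)"
    have h: "0 < h" "rho M z \<le> c * h" using H_pos[OF z z0] low[OF z] by (auto simp: h_def)
    define R where "R = rho M z"
    have R: "0 \<le> R" by (simp add: R_def rho_nonneg)
    define B where "B k = (\<Sum>j\<in>UNIV. real ((fst k + snd k) $ j) *
      monomial_norm (fst k + snd k - axis j 1) z)" for k :: "'n exponent \<times> 'n exponent"
    have "\<exists>D. (mixed_monomial k has_derivative D) (at z) \<and> (\<forall>u. cmod (D u) \<le> B k * norm u)"
      for k :: "'n exponent \<times> 'n exponent"
      unfolding B_def by (rule has_derivative_mixed_monomial[of k z]) blast
    then obtain D where D: "\<And>k. (mixed_monomial k has_derivative D k) (at z)"
      "\<And>k u. cmod (D k u) \<le> B k * norm u"
      by metis
    note D_le = D(2)[unfolded B_def]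
    define DH where "DH u = (\<Sum>k\<in>M. a k * D k u)" for u
    have "(H has_derivative DH) (at z)"
      unfolding H_def DH_def[abs_def] by (intro has_derivative_sum has_derivative_mult_right D)
    then have deriv: "((\<lambda>x. mixed_monomial \<kappa> x / H x) has_derivative
        (\<lambda>u. (D \<kappa> u * H z - mixed_monomial \<kappa> z * DH u) / (H z * H z))) (at z)"
      using h(1) by (intro has_derivative_divide' D) (auto simp: h_def)
    have D1: "cmod (D \<kappa> u) \<le> E1 * R * norm u" for u
    proof -
      have "(\<Sum>j\<in>UNIV. real (\<beta> $ j) * monomial_norm (\<beta> - axis j 1) z) \<le> E1 * R"
        unfolding E1_def sum_distrib_right
      proof (rule sum_mono)
        fix j show "real (\<beta> $ j) * monomial_norm (\<beta> - axis j 1) z \<le> real (\<beta> $ j) * R"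
        proof (cases "\<beta> $ j = 0")
          case False
          then show ?thesis unfolding R_def \<beta>_def
            by (intro mult_left_mono dominated_diff_axis_le_rho \<kappa>) (auto simp: small z)
        qed simp
      qed
      then show ?thesis using D_le[of \<kappa> u] unfolding \<beta>_def
        by (meson mult_right_mono norm_ge_zero order_trans)
    qed
    \<comment> \<open>The monomial and \<open>DH\<close> are estimated together, term by term: a
      derivative of a monomial of \<open>h\<close> is controlled only after multiplication by a
      dominated one.\<close>
    have D2: "cmod (mixed_monomial \<kappa> z * DH u) \<le> E2 * R\<^sup>2 * norm u" for u
    proof -
      have "cmod (mixed_monomial \<kappa> z * DH u) \<le> (\<Sum>k\<in>M. C * (\<Sum>j\<in>UNIV. real ((fst k + snd k) $ j)) * (R\<^sup>2 * norm u))"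
        unfolding DH_def sum_distrib_left[of "mixed_monomial \<kappa> z"]
      proof (rule sum_norm_le)
        fix k assume k: "k \<in> M"
        let ?s = "\<Sum>j\<in>UNIV. real ((fst k + snd k) $ j) * monomial_norm (fst k + snd k - axis j 1) z"
        have "monomial_norm \<beta> z * ?s \<le> (\<Sum>j\<in>UNIV. real ((fst k + snd k) $ j)) * R\<^sup>2"
          unfolding sum_distrib_right sum_distrib_left
        proof (rule sum_mono)
          fix j
          show "monomial_norm \<beta> z * (real ((fst k + snd k) $ j) * monomial_norm (fst k + snd k - axis j 1) z)
             \<le> real ((fst k + snd k) $ j) * R\<^sup>2"
          proof (cases "(fst k + snd k) $ j = 0")
            case False
            then have "monomial_norm \<beta> z * monomial_norm (fst k + snd k - axis j 1) z \<le> R\<^sup>2"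
              unfolding R_def \<beta>_def
              by (intro dominated_times_diff_axis_le_rho \<kappa> k) (auto simp: small z)
            then have "real ((fst k + snd k) $ j) *
               (monomial_norm \<beta> z * monomial_norm (fst k + snd k - axis j 1) z) \<le> real ((fst k + snd k) $ j) * R\<^sup>2"
              by (intro mult_left_mono) auto
            then show ?thesis by (simp only: mult.left_commute)
          next
            case True
            then show ?thesis by (simp only: True of_nat_0)
          qed
        qed
        then have s: "monomial_norm \<beta> z * ?s * norm u \<le> (\<Sum>j\<in>UNIV. real ((fst k + snd k) $ j)) * R\<^sup>2 * norm u"
          by (intro mult_right_mono) auto
        have "cmod (mixed_monomial \<kappa> z * (a k * D k u)) = cmod (a k) * (monomial_norm \<beta> z * cmod (D k u))"
          by (simp add: norm_mult norm_mixed_monomial \<beta>_def)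
        also have "\<dots> \<le> C * (monomial_norm \<beta> z * (?s * norm u))"
          by (intro mult_mono coeff[OF k] mult_left_mono D_le monomial_norm_nonneg C0
              mult_nonneg_nonneg norm_ge_zero)
        also have "\<dots> \<le> C * ((\<Sum>j\<in>UNIV. real ((fst k + snd k) $ j)) * R\<^sup>2 * norm u)"
          using s C0 by (intro mult_left_mono) (auto simp: mult.assoc)
        finally show "cmod (mixed_monomial \<kappa> z * (a k * D k u))
            \<le> C * (\<Sum>j\<in>UNIV. real ((fst k + snd k) $ j)) * (R\<^sup>2 * norm u)"
          by (simp only: mult.assoc)
      qed
      then show ?thesis unfolding E2_def by (simp only: sum_distrib_right mult.assoc)
    qed
    have "cmod ((D \<kappa> u * H z - mixed_monomial \<kappa> z * DH u) / (H z * H z)) \<le> L * norm u" for u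
    proof -
      have "cmod (D \<kappa> u * H z - mixed_monomial \<kappa> z * DH u) \<le> E1 * R * norm u * h + E2 * R\<^sup>2 * norm u"
        using D2[of u] mult_right_mono[OF D1[of u], of h] h(1)
        by (intro order_trans[OF norm_triangle_ineq4] add_mono) (auto simp: norm_mult h_def)
      also have "\<dots> \<le> E1 * (c * h) * norm u * h + E2 * (c * h)\<^sup>2 * norm u"
        using E0 h R by (intro add_mono mult_right_mono mult_left_mono power_mono) (auto simp: R_def)
      also have "\<dots> = (c * E1 + c\<^sup>2 * E2) * norm u * (h * h)"
        by (simp add: power2_eq_square algebra_simps)
      also have "\<dots> \<le> L * norm u * (h * h)"
        using c by (intro mult_right_mono) (auto simp: L E1_def E2_def \<beta>_def)
      finally show ?thesis using h(1)
        by (simp add: norm_divide norm_mult h_def[symmetric] divide_le_eq)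
    qed
    with deriv show "\<exists>D. ((\<lambda>x. mixed_monomial \<kappa> x / H x) has_derivative D) (at z) \<and>
        (\<forall>u. cmod (D u) \<le> L * norm u)" by blast
  qed
qed

end

section \<open>Families of control functions: estimates uniform in the parameter\<close>

lemma rho_cong: "newton_polyhedron M = newton_polyhedron N \<Longrightarrow> rho M = rho N"
  by (simp add: rho_def[abs_def] newton_vertices_def)

text \<open>A monomial of the family occurs in some \<open>h s\<close>, whose polyhedron agrees with
  that of \<open>h t\<close> because their diagrams do. Coefficients that vanish at particular
  parameters are therefore harmless.\<close>

lemma family_newton_polyhedron:
  assumes "analytic_family \<Delta> h" "t \<in> \<Delta>"
    and "\<And>s t. s \<in> \<Delta> \<Longrightarrow> t \<in> \<Delta> \<Longrightarrow>
      newton_diagram (Poly_Mapping.keys (h s)) = newton_diagram (Poly_Mapping.keys (h t))"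
  shows "newton_polyhedron (family_monomials \<Delta> h) = newton_polyhedron (Poly_Mapping.keys (h t))"
proof
  show "newton_polyhedron (family_monomials \<Delta> h) \<subseteq> newton_polyhedron (Poly_Mapping.keys (h t))"
  proof (rule newton_polyhedron_mono)
    fix \<alpha> assume "\<alpha> \<in> supp (family_monomials \<Delta> h)"
    then obtain s where s: "s \<in> \<Delta>" "\<alpha> \<in> supp (Poly_Mapping.keys (h s))"
      unfolding supp_def family_monomials_def by blast
    have "newton_polyhedron (Poly_Mapping.keys (h s)) = newton_polyhedron (Poly_Mapping.keys (h t))"
      by (rule newton_polyhedron_cong) (use assms(3)[OF s(1) assms(2)] in auto)
    then show "real_exponent \<alpha> \<in> newton_polyhedron (Poly_Mapping.keys (h t))"
      using real_exponent_in_newton_polyhedron s(2) by blast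
  qed
  show "newton_polyhedron (Poly_Mapping.keys (h t)) \<subseteq> newton_polyhedron (family_monomials \<Delta> h)"
    by (rule newton_polyhedron_mono, rule real_exponent_in_newton_polyhedron)
      (use assms(2) in \<open>auto simp: supp_def family_monomials_def\<close>)
qed

lemma mixed_eval_family:
  assumes "analytic_family \<Delta> h" "t \<in> \<Delta>"
  shows "mixed_eval (h t) x
    = (\<Sum>k\<in>family_monomials \<Delta> h. Poly_Mapping.lookup (h t) k * mixed_monomial k x)"
  using assms by (intro mixed_eval_superset) (auto simp: analytic_family_def family_monomials_def)

lemma continuous_family_coeff:
  assumes "analytic_family \<Delta> h"
  shows "continuous_on \<Delta> (\<lambda>t. Poly_Mapping.lookup (h t) k)"
proof -
  have "(\<lambda>t. Poly_Mapping.lookup (h t) k) analytic_on \<Delta>"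
    using assms unfolding analytic_family_def by blast
  then show ?thesis by (rule analytic_imp_holomorphic[THEN holomorphic_on_imp_continuous_on])
qed

text \<open>Since the monomials of the whole family are bounded by \<open>rho\<close>, the lower bound on
  \<open>|h\<^sub>t|\<close> at one parameter persists, with uniform constants, at neighbouring parameters.\<close>

lemma (in convenient_newton) uniform_lower_bound:
  fixes a :: "complex \<Rightarrow> ('n exponent \<times> 'n exponent) \<Rightarrow> complex"
  assumes cont: "\<And>k. k \<in> M \<Longrightarrow> continuous (at t0) (\<lambda>t. a t k)"
    and theta: "(\<lambda>x. cmod (\<Sum>k\<in>M. a t0 k * mixed_monomial k x)) \<in> \<Theta>[nhds 0](rho M)"
  obtains c r e where "0 < c" "0 < r" "r \<le> 1" "0 < e"
    "\<And>t x. dist t0 t < e \<Longrightarrow> norm x < r \<Longrightarrow>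
      rho M x \<le> c * cmod (\<Sum>k\<in>M. a t k * mixed_monomial k x)"
proof -
  define H where "H t x = (\<Sum>k\<in>M. a t k * mixed_monomial k x)" for t x
  have "rho M \<in> O[nhds 0](\<lambda>x. cmod (H t0 x))"
    using theta unfolding H_def by (simp add: bigtheta_def bigomega_iff_bigo)
  then obtain c where c: "0 < c" "\<forall>\<^sub>F x in nhds 0. norm (rho M x) \<le> c * norm (cmod (H t0 x))"
    by (rule landau_o.bigE)
  then obtain r where r: "0 < r" "\<And>x. dist x 0 < r \<Longrightarrow> norm (rho M x) \<le> c * norm (cmod (H t0 x))"
    unfolding eventually_nhds_metric by blast
  \<comment> \<open>\<open>S\<close> measures the deviation of the coefficients. Up to 1/(2c) it
    costs at most half of \<open>rho\<close> in the lower bound, which doubles the constant.\<close>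
  define S where "S t = (\<Sum>k\<in>M. cmod (a t k - a t0 k))" for t
  have "continuous (at t0) S"
    unfolding S_def by (intro continuous_intros cont)
  moreover have "0 < 1 / (2 * c)" using c(1) by simp
  ultimately obtain e where e: "0 < e" "\<And>t. dist t t0 < e \<Longrightarrow> dist (S t) (S t0) < 1 / (2 * c)"
    unfolding continuous_at_eps_delta by blast
  show thesis
  proof (rule that[of "2 * c" "min r 1" e])
    fix t and x :: "complex ^ 'n" assume t: "dist t0 t < e" and x: "norm x < min r 1"
    have small: "cmod (x $ j) < 1" for j
      using x Finite_Cartesian_Product.norm_nth_le[of x j] by linarith
    have "S t0 = 0" by (simp add: S_def)
    then have St: "S t \<le> 1 / (2 * c)"
      using e(2)[of t] t by (simp add: dist_commute dist_real_def)
    have "cmod (H t x - H t0 x) \<le> S t * rho M x"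
      unfolding H_def S_def sum_subtractf[symmetric] sum_distrib_right
    proof (rule sum_norm_le)
      fix k assume "k \<in> M"
      have "cmod (a t k * mixed_monomial k x - a t0 k * mixed_monomial k x)
          = cmod (a t k - a t0 k) * monomial_norm (fst k + snd k) x"
        by (simp add: norm_mult norm_mixed_monomial flip: left_diff_distrib)
      also have "\<dots> \<le> cmod (a t k - a t0 k) * rho M x"
        by (intro mult_left_mono monomial_norm_le_rho \<open>k \<in> M\<close> small) auto
      finally show "cmod (a t k * mixed_monomial k x - a t0 k * mixed_monomial k x)
          \<le> cmod (a t k - a t0 k) * rho M x" .
    qed
    also have "\<dots> \<le> 1 / (2 * c) * rho M x" using St by (rule mult_right_mono) (rule rho_nonneg)
    finally have diff: "cmod (H t x - H t0 x) \<le> 1 / (2 * c) * rho M x" .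
    have "rho M x \<le> c * cmod (H t0 x)" using r(2)[of x] x by (simp add: rho_nonneg)
    also have "\<dots> \<le> c * (cmod (H t x) + cmod (H t x - H t0 x))"
      using c(1) norm_triangle_sub[of "H t0 x" "H t x"]
      by (intro mult_left_mono) (auto simp: norm_minus_commute)
    also have "\<dots> \<le> c * (cmod (H t x) + 1 / (2 * c) * rho M x)"
      using diff c(1) by (intro mult_left_mono add_left_mono) auto
    also have "\<dots> = c * cmod (H t x) + rho M x / 2" using c(1) by (simp add: field_simps)
    finally show "rho M x \<le> 2 * c * cmod (\<Sum>k\<in>M. a t k * mixed_monomial k x)"
      by (simp add: H_def)
  qed (use c r e in auto)
qed


lemma finite_family_bounded:
  fixes a :: "'a::topological_space \<Rightarrow> 'k \<Rightarrow> complex"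
  assumes "compact T" "finite K" "\<And>k. k \<in> K \<Longrightarrow> continuous_on T (\<lambda>t. a t k)"
  obtains C where "\<And>t k. t \<in> T \<Longrightarrow> k \<in> K \<Longrightarrow> cmod (a t k) \<le> C"
proof -
  have "compact ((\<lambda>t. \<Sum>k\<in>K. cmod (a t k)) ` T)"
    by (intro compact_continuous_image continuous_intros assms)
  then obtain C where C: "\<forall>s\<in>(\<lambda>t. \<Sum>k\<in>K. cmod (a t k)) ` T. norm s \<le> C"
    using compact_imp_bounded bounded_iff by blast
  have "cmod (a t k) \<le> C" if "t \<in> T" "k \<in> K" for t k
  proof -
    have "cmod (a t k) \<le> (\<Sum>k\<in>K. cmod (a t k))"
      using that assms(2) by (intro member_le_sum) auto
    also have "\<dots> \<le> C" using C that(1) by fastforce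
    finally show ?thesis .
  qed
  with that show thesis by blast
qed

text \<open>The product is expanded into quotients of single mixed monomials by \<open>H\<close>,
  each covered by \<open>quotient_lipschitz\<close>; coefficient bounds over \<open>T\<close> make
  the constant independent of \<open>t\<close>.\<close>

lemma (in convenient_newton) component_lipschitz:
  fixes g :: "'n mixed_poly" and p :: "complex \<Rightarrow> 'n mixed_poly"
    and a :: "complex \<Rightarrow> ('n exponent \<times> 'n exponent) \<Rightarrow> complex"
  defines "H \<equiv> \<lambda>t x. \<Sum>k\<in>M. a t k * mixed_monomial k x"
  assumes N: "finite N" "\<And>t. t \<in> T \<Longrightarrow> Poly_Mapping.keys (p t) \<subseteq> N"
    and p_bound: "\<And>t l. t \<in> T \<Longrightarrow> l \<in> N \<Longrightarrow> cmod (Poly_Mapping.lookup (p t) l) \<le> C'"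
    and a_bound: "\<And>t k. t \<in> T \<Longrightarrow> k \<in> M \<Longrightarrow> cmod (a t k) \<le> C"
    and dom: "\<And>k l. k \<in> Poly_Mapping.keys g \<Longrightarrow> l \<in> N \<Longrightarrow> dominated (fst (k + l) + snd (k + l))"
    and nonzero: "\<And>k l. k \<in> Poly_Mapping.keys g \<Longrightarrow> fst k + snd k \<noteq> 0"
    and c: "0 \<le> c" and r: "r \<le> 1"
    and low: "\<And>t x. t \<in> T \<Longrightarrow> norm x < r \<Longrightarrow> rho M x \<le> c * cmod (H t x)"
  obtains L where "0 \<le> L" "\<And>t x y. t \<in> T \<Longrightarrow> norm x < r \<Longrightarrow> norm y < r \<Longrightarrow>
    cmod (mixed_eval g x * mixed_eval (p t) x / H t x - mixed_eval g y * mixed_eval (p t) y / H t y)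
      \<le> L * norm (x - y)"
proof -
  define L0 where "L0 k l = c + c * (\<Sum>j\<in>UNIV. real ((fst (k + l) + snd (k + l)) $ j))
      + c\<^sup>2 * (\<Sum>k\<in>M. C * (\<Sum>j\<in>UNIV. real ((fst k + snd k) $ j)))" for k l :: "'n exponent \<times> 'n exponent"
  define L where "L = (\<Sum>k\<in>Poly_Mapping.keys g. \<Sum>l\<in>N. cmod (Poly_Mapping.lookup g k) * C' * L0 k l)"
  have expand: "mixed_eval g x * mixed_eval (p t) x / H t x
      = (\<Sum>k\<in>Poly_Mapping.keys g. \<Sum>l\<in>N. Poly_Mapping.lookup g k * Poly_Mapping.lookup (p t) l *
          (mixed_monomial (k + l) x / H t x))" if "t \<in> T" for t x
    unfolding mixed_eval_eq[of g] mixed_eval_superset[OF N(1) N(2)[OF that]]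
      sum_product sum_divide_distrib mixed_monomial_plus
    by (intro sum.cong refl) simp
  have "cmod (mixed_eval g x * mixed_eval (p t) x / H t x - mixed_eval g y * mixed_eval (p t) y / H t y)
      \<le> L * norm (x - y)" if t: "t \<in> T" and xy: "norm x < r" "norm y < r" for t x y
    unfolding expand[OF t] sum_subtractf[symmetric] L_def sum_distrib_right
  proof (intro sum_norm_le)
    fix k l assume k: "k \<in> Poly_Mapping.keys g" and l: "l \<in> N"
    have "fst (k + l) + snd (k + l) \<noteq> 0"
    proof
      assume "fst (k + l) + snd (k + l) = 0"
      then have "fst k + snd k = 0" by (auto simp: vec_eq_iff)
      then show False using nonzero k by blast
    qed
    then have quot: "cmod (mixed_monomial (k + l) x / H t x - mixed_monomial (k + l) y / H t y)
        \<le> L0 k l * norm (x - y)"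
      unfolding H_def
      by (intro quotient_lipschitz[where C = C and c = c and r = r] dom k l a_bound t c r xy L0_def)
        (use low[OF t] in \<open>auto simp: H_def\<close>)
    have "cmod (Poly_Mapping.lookup g k * Poly_Mapping.lookup (p t) l * (mixed_monomial (k + l) x / H t x) -
        Poly_Mapping.lookup g k * Poly_Mapping.lookup (p t) l * (mixed_monomial (k + l) y / H t y))
      = cmod (Poly_Mapping.lookup g k) * cmod (Poly_Mapping.lookup (p t) l) *
        cmod (mixed_monomial (k + l) x / H t x - mixed_monomial (k + l) y / H t y)"
      by (simp only: right_diff_distrib[symmetric] norm_mult)
    also have "\<dots> \<le> cmod (Poly_Mapping.lookup g k) * C' * (L0 k l * norm (x - y))"
      using p_bound[OF t l] order_trans[OF norm_ge_zero p_bound[OF t l]]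
      by (intro mult_mono quot mult_nonneg_nonneg) auto
    finally show "cmod (Poly_Mapping.lookup g k * Poly_Mapping.lookup (p t) l * (mixed_monomial (k + l) x / H t x) -
        Poly_Mapping.lookup g k * Poly_Mapping.lookup (p t) l * (mixed_monomial (k + l) y / H t y))
      \<le> cmod (Poly_Mapping.lookup g k) * C' * L0 k l * norm (x - y)" by (simp only: mult.assoc)
  qed
  \<comment> \<open>The absolute value is for an empty \<open>T\<close>, where \<open>C\<close> and
    \<open>C'\<close> are arbitrary and \<open>L\<close> may be negative.\<close>
  then have "cmod (mixed_eval g x * mixed_eval (p t) x / H t x - mixed_eval g y * mixed_eval (p t) y / H t y)
      \<le> \<bar>L\<bar> * norm (x - y)" if "t \<in> T" "norm x < r" "norm y < r" for t x y
    using that by (meson abs_ge_self mult_right_mono norm_ge_zero order_trans)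
  then show thesis using that[of "\<bar>L\<bar>"] by simp
qed

text \<open>Weights of exponents add under multiplication, so the two filtrations together bound the
  weight of each product monomial from below. The given \<open>k\<close> and \<open>l\<close> make
  both sets nonempty, hence all filtrations real.\<close>

lemma (in convenient_newton) dominated_if_fil:
  assumes "k \<in> K" "l \<in> N"
    and fil: "\<And>\<sigma>. compact_facet \<sigma> M \<Longrightarrow>
      fil (w \<sigma>) K + fil (w \<sigma>) N - fil (w \<sigma>) M - ereal (max_weight (w \<sigma>)) \<ge> 0"
    and "finite K" "finite N"
  shows "dominated (fst (k + l) + snd (k + l))"
  unfolding dominated_def
proof (intro allI impI)
  fix \<sigma> assume \<sigma>: "compact_facet \<sigma> M"
  obtain r where r: "fil (w \<sigma>) M = ereal r" using fil_finite[OF finite nonempty] .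
  obtain s where s: "fil (w \<sigma>) K = ereal s" using fil_finite[OF \<open>finite K\<close>] assms(1) by blast
  obtain u where u: "fil (w \<sigma>) N = ereal u" using fil_finite[OF \<open>finite N\<close>] assms(2) by blast
  have "s \<le> w \<sigma> \<bullet> real_exponent (fst k + snd k)" "u \<le> w \<sigma> \<bullet> real_exponent (fst l + snd l)"
    using fil_le[OF assms(1), of "w \<sigma>"] fil_le[OF assms(2), of "w \<sigma>"] s u by auto
  moreover have "0 \<le> s + u - r - max_weight (w \<sigma>)" using fil[OF \<sigma>] by (simp add: r s u zero_ereal_def)
  moreover have "real_exponent (fst (k + l) + snd (k + l))
      = real_exponent (fst k + snd k) + real_exponent (fst l + snd l)"
    by (simp add: real_exponent_def vec_eq_iff)
  ultimately show "fil (w \<sigma>) M + ereal (max_weight (w \<sigma>))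
      \<le> ereal (w \<sigma> \<bullet> real_exponent (fst (k + l) + snd (k + l)))"
    by (simp add: r inner_add_right)
qed


section \<open>Flows along rays\<close>

lemma integral_0_1_norm_le:
  fixes f :: "real \<Rightarrow> 'a::euclidean_space"
  assumes "continuous_on {0..1} f" "\<And>\<tau>. \<tau> \<in> {0..1} \<Longrightarrow> norm (f \<tau>) \<le> B"
  shows "norm (integral {0..1} f) \<le> B"
  using integral_bound[of 0 1 f B] assms by simp

text \<open>It converts the operator of \<open>ray_flow\<close>, which always integrates over [0,1],
  into an integral up to \<open>s\<close> along a fixed ray, from which the differential equation is
  read off.\<close>

lemma integral_rescale_0_1:
  fixes k :: "real \<Rightarrow> 'a::euclidean_space"
  assumes "0 \<le> s"
  shows "integral {0..1} (\<lambda>\<tau>. s *\<^sub>R k (s * \<tau>)) = integral {0..s} k"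
proof (cases "s = 0")
  case False
  then have "(\<lambda>x. x / s) ` {0..s} = {0..1}"
    using assms by (force simp: image_iff field_simps intro: bexI[of _ "_ * s"])
  then show ?thesis
    using integral_stretch_real[of s 0 s k] False assms by (simp add: integral_cmul)
qed simp

text \<open>The solutions of the differential equation along all rays from the base point of the
  parameter space are obtained at once, as the fixed point of the integral operator on the bounded
  continuous displacements; this makes joint continuity automatic, and the Lipschitz estimate for
  the displacement is an invariant of the operator.\<close>

lemma ray_flow:
  fixes G :: "'p::euclidean_space \<Rightarrow> 'p \<Rightarrow> 'a::euclidean_space \<Rightarrow> 'a"
  assumes cont: "continuous_on UNIV (\<lambda>(a, b, x). G a b x)"
    and lip: "\<And>a b x y. norm (G a b x - G a b y) \<le> L * norm a * norm (x - y)"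
    and bound: "\<And>a b x. norm (G a b x) \<le> B * norm a"
    and zero: "\<And>a b. G a b 0 = 0"
    and scale: "\<And>s a b x. G (s *\<^sub>R a) b x = s *\<^sub>R G a b x"
    and L: "0 \<le> L" "0 \<le> B" and d: "0 < d" "d * L \<le> 1 / 3"
  obtains X :: "'p \<Rightarrow> 'a \<Rightarrow> 'a" where
    "continuous_on UNIV (\<lambda>(a, x). X a x)"
    "\<And>a. X a 0 = 0" "\<And>x. X 0 x = x"
    "\<And>a x y. norm ((X a x - x) - (X a y - y)) \<le> (1 / 2) * norm (x - y)"
    "\<And>a x s. norm a \<le> d \<Longrightarrow> s \<in> {0..1} \<Longrightarrow>
      ((\<lambda>s. X (s *\<^sub>R a) x) has_vector_derivative G a (s *\<^sub>R a) (X (s *\<^sub>R a) x)) (at s within {0..1})"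
proof -
  \<comment> \<open>Projecting the parameter to the ball of radius \<open>d\<close> makes the
    integral operator bounded and contracting on the whole space.\<close>
  define p :: "'p \<Rightarrow> 'p" where "p = closest_point (cball 0 d)"
  have p_in: "norm (p a) \<le> d" for a
    using closest_point_in_set[of "cball 0 d" a] d(1) by (simp add: p_def)
  have p_id: "p a = a" if "norm a \<le> d" for a
    using closest_point_self[of a "cball 0 d"] that by (simp add: p_def)
  have p_cont: "continuous_on S p" for S
    unfolding p_def using continuous_on_closest_point[of "cball 0 d"] d(1) by simp
  have G_cont: "continuous_on S (\<lambda>z. G (f1 z) (f2 z) (f3 z))"
    if "continuous_on S f1" "continuous_on S f2" "continuous_on S f3"
    for S :: "'q::topological_space set" and f1 f2 f3
    using continuous_on_compose2[OF cont, of S "\<lambda>z. (f1 z, f2 z, f3 z)"] that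
    by (simp add: continuous_on_Pair)
  \<comment> \<open>\<open>u\<close> at \<open>(b, x)\<close> stands for the displacement of
    \<open>x\<close> at parameter \<open>b\<close>; for a fixed point it is the integral of the
    velocity along the segment from 0 to \<open>p b\<close>.\<close>
  define k where "k u a x \<tau> = G (p a) (\<tau> *\<^sub>R p a) (x + apply_bcontfun u (\<tau> *\<^sub>R p a, x))"
    for u :: "('p \<times> 'a) \<Rightarrow>\<^sub>C 'a" and a x \<tau>
  have u_cont: "continuous_on S (\<lambda>z. apply_bcontfun u (f z))" if "continuous_on S f"
    for S :: "'q::topological_space set" and f and u :: "('p \<times> 'a) \<Rightarrow>\<^sub>C 'a"
    using continuous_on_compose2[OF continuous_on_apply_bcontfun that, of UNIV] by simp
  have k_cont: "continuous_on S (k u a x)" for S u a x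
    unfolding k_def by (intro G_cont u_cont continuous_intros)
  define T where "T u = Bcontfun (\<lambda>(a, x). integral {0..1} (k u a x))" for u
  have Gd: "norm (G (p a) b x) \<le> B * d" for a b x
    using bound[of "p a" b x] p_in[of a] L(2) by (meson mult_left_mono order_trans)
  have Glip: "norm (G (p a) b x - G (p a) b y) \<le> (1/3) * norm (x - y)" for a b x y
  proof -
    have "L * norm (p a) \<le> 1/3"
      using p_in[of a] L(1) d(2) by (metis mult.commute mult_left_mono order_trans)
    then show ?thesis by (intro order_trans[OF lip] mult_right_mono) auto
  qed
  have T: "apply_bcontfun (T u) (a, x) = integral {0..1} (k u a x)" for u a x
  proof -
    have "(\<lambda>(a, x). integral {0..1} (k u a x)) \<in> bcontfun"
    proof (rule bcontfun_normI)
      have "continuous_on (UNIV \<times> cbox 0 1) (\<lambda>(z, \<tau>). k u (fst z) (snd z) \<tau>)"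
        unfolding k_def case_prod_beta
        by (intro G_cont u_cont continuous_intros continuous_on_compose2[OF p_cont[of UNIV]]) auto
      from integral_continuous_on_param[OF this]
      show "continuous_on UNIV (\<lambda>(a, x). integral {0..1} (k u a x))"
        by (simp add: case_prod_beta)
      show "norm (case z of (a, x) \<Rightarrow> integral {0..1} (k u a x)) \<le> B * d" for z
        by (cases z) (auto intro!: integral_0_1_norm_le k_cont simp: Gd k_def)
    qed
    then show ?thesis by (simp add: T_def Bcontfun_inverse)
  qed
  define S where "S = {u :: ('p \<times> 'a) \<Rightarrow>\<^sub>C 'a. (\<forall>a. apply_bcontfun u (a, 0) = 0) \<and>
    (\<forall>a x y. norm (apply_bcontfun u (a, x) - apply_bcontfun u (a, y)) \<le> (1 / 2) * norm (x - y))}"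
  have eval: "continuous_on UNIV (\<lambda>u :: ('p \<times> 'a) \<Rightarrow>\<^sub>C 'a. apply_bcontfun u z)" for z
    by (intro lipschitz_on_continuous_on[of 1] lipschitz_onI) (auto intro: dist_bounded)
  have "closed S"
  proof -
    have "S = (\<Inter>a. {u. apply_bcontfun u (a, 0) = 0}) \<inter>
      (\<Inter>a x y. {u. norm (apply_bcontfun u (a, x) - apply_bcontfun u (a, y)) \<le> (1 / 2) * norm (x - y)})"
      unfolding S_def by auto
    moreover have "closed {u :: ('p \<times> 'a) \<Rightarrow>\<^sub>C 'a. apply_bcontfun u (a, 0) = 0}" for a
      by (intro closed_Collect_eq eval continuous_intros)
    moreover have "closed {u :: ('p \<times> 'a) \<Rightarrow>\<^sub>C 'a.
        norm (apply_bcontfun u (a, x) - apply_bcontfun u (a, y)) \<le> (1 / 2) * norm (x - y)}" for a x y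
      by (intro closed_Collect_le eval continuous_intros)
    ultimately show ?thesis by (auto intro!: closed_Int closed_INT)
  qed
  have "\<exists>!u\<in>S. T u = u"
  proof (rule Banach_fix[of S "1/3"])
    show "complete S" using \<open>closed S\<close> by (simp add: complete_eq_closed)
    have "0 \<in> S" by (simp add: S_def)
    then show "S \<noteq> {}" by blast
    show "T ` S \<subseteq> S"
    proof clarify
      fix u assume "u \<in> S"
      then have u: "apply_bcontfun u (a, 0) = 0"
        "norm (apply_bcontfun u (a, x) - apply_bcontfun u (a, y)) \<le> (1 / 2) * norm (x - y)" for a x y
        by (auto simp: S_def)
      show "T u \<in> S" unfolding S_def
      proof (intro CollectI conjI allI)
        show "apply_bcontfun (T u) (a, 0) = 0" for a
          using u(1) by (simp add: T k_def[abs_def] zero)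
        show "norm (apply_bcontfun (T u) (a, x) - apply_bcontfun (T u) (a, y)) \<le> (1/2) * norm (x - y)"
          for a x y
        proof -
          have "apply_bcontfun (T u) (a, x) - apply_bcontfun (T u) (a, y)
              = integral {0..1} (\<lambda>\<tau>. k u a x \<tau> - k u a y \<tau>)"
            unfolding T by (rule integral_diff[symmetric]; rule integrable_continuous_real; rule k_cont)
          also have "norm \<dots> \<le> (1/2) * norm (x - y)"
          proof (intro integral_0_1_norm_le continuous_intros k_cont)
            fix \<tau> :: real
            let ?X = "\<lambda>x. x + apply_bcontfun u (\<tau> *\<^sub>R p a, x)"
            have "norm (?X x - ?X y)
                = norm ((x - y) + (apply_bcontfun u (\<tau> *\<^sub>R p a, x) - apply_bcontfun u (\<tau> *\<^sub>R p a, y)))"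
              by (simp add: algebra_simps)
            also have "\<dots> \<le> norm (x - y) + (1/2) * norm (x - y)"
              using u(2) norm_triangle_ineq order_trans add_left_mono by meson
            \<comment> \<open>Since 1/3 times 3/2 is 1/2, the Lipschitz bound of the displacement
              reproduces itself.\<close>
            finally show "norm (k u a x \<tau> - k u a y \<tau>) \<le> (1/2) * norm (x - y)"
              unfolding k_def using Glip[of a "\<tau> *\<^sub>R p a" "?X x" "?X y"] by linarith
          qed
          finally show ?thesis .
        qed
      qed
    qed
    show "dist (T u) (T v) \<le> 1/3 * dist u v" for u v
    proof (rule dist_bound)
      fix z :: "'p \<times> 'a"
      obtain a x where z: "z = (a, x)" by fastforce
      have "apply_bcontfun (T u) (a, x) - apply_bcontfun (T v) (a, x)
          = integral {0..1} (\<lambda>\<tau>. k u a x \<tau> - k v a x \<tau>)"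
        unfolding T by (rule integral_diff[symmetric]; rule integrable_continuous_real; rule k_cont)
      also have "norm \<dots> \<le> 1/3 * dist u v"
      proof (intro integral_0_1_norm_le continuous_intros k_cont)
        fix \<tau> :: real
        have "norm (apply_bcontfun u (\<tau> *\<^sub>R p a, x) - apply_bcontfun v (\<tau> *\<^sub>R p a, x)) \<le> dist u v"
          using dist_bounded[of u "(\<tau> *\<^sub>R p a, x)" v] by (simp add: dist_norm)
        then show "norm (k u a x \<tau> - k v a x \<tau>) \<le> 1/3 * dist u v"
          unfolding k_def using Glip[of a "\<tau> *\<^sub>R p a" "x + apply_bcontfun u (\<tau> *\<^sub>R p a, x)"
            "x + apply_bcontfun v (\<tau> *\<^sub>R p a, x)"] by simp
      qed
      finally show "dist (apply_bcontfun (T u) z) (apply_bcontfun (T v) z) \<le> 1/3 * dist u v"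
        by (simp add: z dist_norm)
    qed
  qed auto
  then obtain u where u: "u \<in> S" "T u = u" by blast
  define X where "X a x = x + apply_bcontfun u (a, x)" for a x
  have X_int: "X (s *\<^sub>R a) x = x + integral {0..s} (\<lambda>\<sigma>. G a (\<sigma> *\<^sub>R a) (X (\<sigma> *\<^sub>R a) x))"
    if a: "norm a \<le> d" and s: "s \<in> {0..1}" for a :: 'p and x s
  proof -
    have "norm (s *\<^sub>R a) \<le> d"
      using a s by (simp add: mult_left_le_one_le order_trans[OF _ a])
    \<comment> \<open>\<open>G\<close> is homogeneous in the direction, so the ray to
      \<open>s a\<close> is the ray to \<open>a\<close> run at speed \<open>s\<close>.\<close>
    then have "k u (s *\<^sub>R a) x = (\<lambda>\<tau>. s *\<^sub>R G a ((s * \<tau>) *\<^sub>R a) (X ((s * \<tau>) *\<^sub>R a) x))"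
      by (simp add: k_def p_id X_def scale fun_eq_iff mult.commute)
    then have "apply_bcontfun u (s *\<^sub>R a, x) = integral {0..s} (\<lambda>\<sigma>. G a (\<sigma> *\<^sub>R a) (X (\<sigma> *\<^sub>R a) x))"
      using T[of u "s *\<^sub>R a" x] u(2) s
        integral_rescale_0_1[of s "\<lambda>\<sigma>. G a (\<sigma> *\<^sub>R a) (X (\<sigma> *\<^sub>R a) x)"] by simp
    then show ?thesis by (simp add: X_def)
  qed
  show thesis
  proof (rule that[of X])
    show "continuous_on UNIV (\<lambda>(a, x). X a x)"
      unfolding X_def case_prod_beta by (intro continuous_intros u_cont)
    show "X a 0 = 0" for a using u(1) by (simp add: X_def S_def)
    show "X 0 x = x" for x using X_int[of 0 0 x] d(1) by simp
    show "norm ((X a x - x) - (X a y - y)) \<le> (1 / 2) * norm (x - y)" for a x y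
      using u(1) by (simp add: X_def S_def)
  next
    fix a :: 'p and x and s :: real assume as: "norm a \<le> d" "s \<in> {0..1}"
    have "continuous_on {0..1} (\<lambda>\<sigma>. G a (\<sigma> *\<^sub>R a) (X (\<sigma> *\<^sub>R a) x))"
      unfolding X_def by (intro G_cont u_cont continuous_intros)
    from integral_has_vector_derivative[OF this as(2)]
    have "((\<lambda>s. x + integral {0..s} (\<lambda>\<sigma>. G a (\<sigma> *\<^sub>R a) (X (\<sigma> *\<^sub>R a) x)))
      has_vector_derivative G a (s *\<^sub>R a) (X (s *\<^sub>R a) x)) (at s within {0..1})"
      by (auto intro: derivative_eq_intros)
    then show "((\<lambda>s. X (s *\<^sub>R a) x) has_vector_derivative G a (s *\<^sub>R a) (X (s *\<^sub>R a) x))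
        (at s within {0..1})"
      by (rule has_vector_derivative_transform[OF as(2), rotated]) (use X_int as(1) in auto)
  qed
qed

text \<open>The constants are 1 + 1/2 = 3/2 and, for the inverse, 1/(1 - 1/2) = 2. The image is open
  by invariance of domain.\<close>

lemma bilipschitz_homeo_perturbation:
  fixes \<phi> :: "'a::euclidean_space \<Rightarrow> 'a"
  assumes "open V" and pert: "\<And>x y. norm ((\<phi> x - x) - (\<phi> y - y)) \<le> (1 / 2) * norm (x - y)"
  shows "open (\<phi> ` V)" "bilipschitz_homeo V (\<phi> ` V) \<phi>"
proof -
  have split: "\<phi> x - \<phi> y = (x - y) + ((\<phi> x - x) - (\<phi> y - y))" for x y by simp
  have upper: "norm (\<phi> x - \<phi> y) \<le> (3 / 2) * norm (x - y)" for x y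
    using norm_triangle_ineq[of "x - y" "(\<phi> x - x) - (\<phi> y - y)"] pert[of x y]
    unfolding split[symmetric] by linarith
  have lower: "norm (x - y) \<le> 2 * norm (\<phi> x - \<phi> y)" for x y
    using norm_triangle_ineq4[of "\<phi> x - \<phi> y" "(\<phi> x - x) - (\<phi> y - y)"] pert[of x y] by simp
  have inj: "inj \<phi>"
  proof (rule injI)
    fix x y assume "\<phi> x = \<phi> y"
    then show "x = y" using lower[of x y] by simp
  qed
  have lip: "(3/2)-lipschitz_on V \<phi>"
    by (rule lipschitz_onI) (use upper in \<open>auto simp: dist_norm\<close>)
  have lip': "2-lipschitz_on (\<phi> ` V) (inv \<phi>)"
    by (rule lipschitz_onI) (use lower inj in \<open>auto simp: dist_norm\<close>)
  have "homeomorphism V (\<phi> ` V) \<phi> (inv \<phi>)"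
    unfolding homeomorphism_def
    using lip lip' inj by (auto simp: lipschitz_on_continuous_on image_image)
  then show "bilipschitz_homeo V (\<phi> ` V) \<phi>" unfolding bilipschitz_homeo_def
    using lip lip' by blast
  show "open (\<phi> ` V)"
    by (intro invariance_of_domain lipschitz_on_continuous_on[OF lip] assms(1) inj_on_subset[OF inj]) auto
qed


section \<open>The pencil \<open>f + t g\<close> and its constancy along integral curves\<close>

lemma lookup_map_scale:
  "Poly_Mapping.lookup (Poly_Mapping.map (\<lambda>c. t * c) g) k = t * Poly_Mapping.lookup g k"
  for t :: "'a::semiring_0"
  by (simp add: map.rep_eq when_def)

lemma mixed_eval_pencil:
  fixes f g :: "'n::finite mixed_poly"
  shows "mixed_eval (f + Poly_Mapping.map (\<lambda>c. t * c) g) x = mixed_eval f x + t * mixed_eval g x"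
proof -
  let ?A = "Poly_Mapping.keys f \<union> Poly_Mapping.keys g"
  have "Poly_Mapping.keys (f + Poly_Mapping.map (\<lambda>c. t * c) g) \<subseteq> ?A"
    by (auto simp: in_keys_iff lookup_add lookup_map_scale)
  from mixed_eval_superset[OF _ this] show ?thesis
    by (simp add: mixed_eval_superset[of ?A] lookup_add lookup_map_scale distrib_right mult.assoc
        sum.distrib sum_distrib_left)
qed

lemma ordinary_pencil:
  assumes "ordinary_poly f" "ordinary_poly g"
  shows "ordinary_poly (f + Poly_Mapping.map (\<lambda>c. t * c) g)"
proof -
  have "Poly_Mapping.keys (f + Poly_Mapping.map (\<lambda>c. t * c) g)
      \<subseteq> Poly_Mapping.keys f \<union> Poly_Mapping.keys g"
    by (auto simp: in_keys_iff lookup_add lookup_map_scale)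
  then show ?thesis using assms unfolding ordinary_poly_def by blast
qed

lemma ordinary_exponent_nonzero:
  assumes "ordinary_poly g" "mixed_eval g 0 = 0" "k \<in> Poly_Mapping.keys g"
  shows "fst k + snd k \<noteq> 0"
proof
  assume "fst k + snd k = 0"
  moreover have "snd k = 0" using assms(1,3) by (auto simp: ordinary_poly_def)
  ultimately have k: "k = (0, 0)" by (metis add.right_neutral prod.collapse)
  have "mixed_monomial l (0 :: complex ^ 'a) = (if l = (0, 0) then 1 else 0)"
    if "l \<in> Poly_Mapping.keys g" for l
  proof (cases "fst l = 0")
    case True
    then show ?thesis using assms(1) that
      by (cases l) (auto simp: ordinary_poly_def mixed_monomial_def)
  next
    case False
    then obtain j where "fst l $ j \<noteq> 0" by (metis vec_eq_iff zero_index)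
    then show ?thesis using False
      by (auto simp: mixed_monomial_def intro!: bexI[of _ j])
  qed
  then have "mixed_eval g 0 = (\<Sum>l\<in>Poly_Mapping.keys g. Poly_Mapping.lookup g l * (if l = (0, 0) then 1 else 0))"
    unfolding mixed_eval_eq by (intro sum.cong) auto
  also have "\<dots> = Poly_Mapping.lookup g (0, 0)"
    using assms(3) k by (simp add: if_distrib cong: if_cong)
  finally show False using assms(2,3) k by (simp add: in_keys_iff)
qed

text \<open>Along the curve the value changes at the rate of the differential of \<open>F\<close>
  applied to the velocity, plus \<open>a g\<close> from the moving parameter; \<open>tangent\<close>
  says that the two cancel.\<close>

lemma pencil_constant_along_curve:
  fixes f g :: "'n::finite mixed_poly" and \<gamma> \<gamma>' :: "real \<Rightarrow> complex ^ 'n"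
  defines "F \<equiv> \<lambda>t. f + Poly_Mapping.map (\<lambda>c. t * c) g"
  assumes ord: "ordinary_poly f" "ordinary_poly g"
    and deriv: "\<And>s. s \<in> {0..1} \<Longrightarrow> (\<gamma> has_vector_derivative \<gamma>' s) (at s within {0..1})"
    and tangent: "\<And>s. s \<in> {0..1} \<Longrightarrow>
      (\<Sum>i\<in>UNIV. partial_deriv i (mixed_eval (F (t0 + s *\<^sub>R a))) (\<gamma> s) * \<gamma>' s $ i) = - a * mixed_eval g (\<gamma> s)"
  shows "mixed_eval (F (t0 + a)) (\<gamma> 1) = mixed_eval (F t0) (\<gamma> 0)"
proof -
  define W where "W s = mixed_eval f (\<gamma> s) + (t0 + s *\<^sub>R a) * mixed_eval g (\<gamma> s)" for s
  have "(W has_vector_derivative 0) (at s within {0..1})" if s: "s \<in> {0..1}" for s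
  proof -
    define Df where "Df u = (\<Sum>i\<in>UNIV. partial_deriv i (mixed_eval f) (\<gamma> s) * u $ i)" for u
    define Dg where "Dg u = (\<Sum>i\<in>UNIV. partial_deriv i (mixed_eval g) (\<gamma> s) * u $ i)" for u
    let ?t = "t0 + s *\<^sub>R a"
    have Df: "(mixed_eval f has_derivative Df) (at (\<gamma> s))" and Dg: "(mixed_eval g has_derivative Dg) (at (\<gamma> s))"
      unfolding Df_def[abs_def] Dg_def[abs_def] by (intro has_derivative_mixed_eval_ordinary ord)+
    \<comment> \<open>The derivative is computed twice, from \<open>f\<close> and \<open>g\<close>
      and from the partial derivatives of \<open>F ?t\<close>; uniqueness translates
      \<open>tangent\<close> into a statement about \<open>Df\<close> and \<open>Dg\<close>.\<close>
    have "(mixed_eval (F ?t) has_derivative (\<lambda>u. Df u + ?t * Dg u)) (at (\<gamma> s))"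
      unfolding F_def mixed_eval_pencil[abs_def]
      by (intro has_derivative_add has_derivative_mult_right Df Dg)
    moreover have "(mixed_eval (F ?t) has_derivative
        (\<lambda>u. \<Sum>i\<in>UNIV. partial_deriv i (mixed_eval (F ?t)) (\<gamma> s) * u $ i)) (at (\<gamma> s))"
      unfolding F_def by (intro has_derivative_mixed_eval_ordinary ordinary_pencil ord)
    ultimately have "(\<lambda>u. Df u + ?t * Dg u)
        = (\<lambda>u. \<Sum>i\<in>UNIV. partial_deriv i (mixed_eval (F ?t)) (\<gamma> s) * u $ i)"
      by (rule has_derivative_unique)
    from fun_cong[OF this, of "\<gamma>' s"] have zero: "Df (\<gamma>' s) + ?t * Dg (\<gamma>' s) + a * mixed_eval g (\<gamma> s) = 0"
      using tangent[OF s] by simp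
    have f: "((\<lambda>s. mixed_eval f (\<gamma> s)) has_vector_derivative Df (\<gamma>' s)) (at s within {0..1})"
      using vector_derivative_diff_chain_within[OF deriv[OF s], of "mixed_eval f" Df] has_derivative_at_withinI[OF Df]
      by (simp add: o_def)
    have g: "((\<lambda>s. mixed_eval g (\<gamma> s)) has_vector_derivative Dg (\<gamma>' s)) (at s within {0..1})"
      using vector_derivative_diff_chain_within[OF deriv[OF s], of "mixed_eval g" Dg] has_derivative_at_withinI[OF Dg]
      by (simp add: o_def)
    have "(W has_vector_derivative Df (\<gamma>' s) + (?t * Dg (\<gamma>' s) + a * mixed_eval g (\<gamma> s))) (at s within {0..1})"
      unfolding W_def[abs_def]
      by (intro has_vector_derivative_add f has_vector_derivative_mult g) (auto intro!: derivative_eq_intros)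
    then show ?thesis using zero by (simp add: add.assoc)
  qed
  then obtain c where "\<And>s. s \<in> {0..1} \<Longrightarrow> W s = c"
    using has_vector_derivative_zero_constant[of "{0..1}" W] by (auto simp: convex_real_interval)
  then have "W 1 = W 0" by simp
  then show ?thesis by (simp add: W_def F_def mixed_eval_pencil)
qed


section \<open>Lipschitz triviality\<close>

theorem theorem5p4:
  fixes \<Delta> :: "complex set"
    and f g :: "'n::finite mixed_poly"
    and F h :: "complex \<Rightarrow> 'n mixed_poly"
    and P :: "'n \<Rightarrow> complex \<Rightarrow> 'n mixed_poly"
    and w :: "(real ^ 'n) set \<Rightarrow> real ^ 'n"
  assumes "open \<Delta>"
    and "ordinary_poly f" and "ordinary_poly g"
    and F_def: "\<And>t. F t = f + Poly_Mapping.map (\<lambda>c. t * c) g"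
    and "\<And>t. t \<in> \<Delta> \<Longrightarrow> mixed_eval (F t) 0 = 0"
    and "\<And>t. t \<in> \<Delta> \<Longrightarrow> isolated_singularity (mixed_eval (F t))"
    and "\<And>s t. s \<in> \<Delta> \<Longrightarrow> t \<in> \<Delta> \<Longrightarrow>
      newton_diagram (Poly_Mapping.keys (F s)) = newton_diagram (Poly_Mapping.keys (F t))"
    and "\<And>i. analytic_family \<Delta> (P i)"
    and "analytic_family \<Delta> h"
    and "\<And>t. t \<in> \<Delta> \<Longrightarrow> control_function (h t)"
    and "\<And>t x. t \<in> \<Delta> \<Longrightarrow>
      mixed_eval (h t) x = (\<Sum>i\<in>UNIV. mixed_eval (P i t) x * partial_deriv i (mixed_eval (F t)) x)"
    and "\<And>s t. s \<in> \<Delta> \<Longrightarrow> t \<in> \<Delta> \<Longrightarrow>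
      newton_diagram (Poly_Mapping.keys (h s)) = newton_diagram (Poly_Mapping.keys (h t))"
    and "\<And>\<sigma>. compact_facet \<sigma> (family_monomials \<Delta> h) \<Longrightarrow> associated_weight (w \<sigma>) \<sigma>"
    and "\<And>\<sigma> i. compact_facet \<sigma> (family_monomials \<Delta> h) \<Longrightarrow>
      fil (w \<sigma>) (Poly_Mapping.keys g) + fil (w \<sigma>) (family_monomials \<Delta> (P i))
        - fil (w \<sigma>) (family_monomials \<Delta> h) - ereal (max_weight (w \<sigma>)) \<ge> 0"
  shows "lipschitz_trivial \<Delta> (\<lambda>t. mixed_eval (F t))"
  unfolding lipschitz_trivial_def
proof (rule ballI)
  note family_P = assms(8) and family_h = assms(9) and control = assms(10) and hP = assms(11)
    and diagram_h = assms(12) and fil = assms(14)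
  fix t0 assume t0: "t0 \<in> \<Delta>"
  define M where "M = family_monomials \<Delta> h"
  define a where "a t = Poly_Mapping.lookup (h t)" for t
  have finM: "finite M" using family_h by (simp add: M_def analytic_family_def family_monomials_def)
  have "Poly_Mapping.keys (h t0) \<noteq> {}" using control[OF t0] by (simp add: control_function_def)
  then have neM: "M \<noteq> {}" using t0 by (auto simp: M_def family_monomials_def)
  have polyhedron: "newton_polyhedron M = newton_polyhedron (Poly_Mapping.keys (h t0))"
    unfolding M_def by (rule family_newton_polyhedron[OF family_h t0 diagram_h])
  interpret convenient_newton M w
  proof
    show "\<exists>s. axis i s \<in> newton_polyhedron M" for i
      using control[OF t0] newton_diagram_subset unfolding polyhedron control_function_def convenient_def
      by blast
    show "associated_weight (w \<sigma>) \<sigma>" if "compact_facet \<sigma> M" for \<sigma>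
      using that assms(13) by (simp add: M_def)
  qed (use finM neM in auto)
  have H: "mixed_eval (h t) x = (\<Sum>k\<in>M. a t k * mixed_monomial k x)" if "t \<in> \<Delta>" for t x
    unfolding M_def a_def by (rule mixed_eval_family[OF family_h that])
  have a_cont: "continuous_on \<Delta> (\<lambda>t. a t k)" for k
    unfolding a_def by (rule continuous_family_coeff[OF family_h])
  have theta: "(\<lambda>x. cmod (\<Sum>k\<in>M. a t0 k * mixed_monomial k x)) \<in> \<Theta>[nhds 0](rho M)"
    using control[OF t0] rho_cong[OF polyhedron] by (simp add: control_function_def flip: H[OF t0])
  have cont: "continuous (at t0) (\<lambda>t. a t k)" if "k \<in> M" for k
    using a_cont t0 \<open>open \<Delta>\<close> continuous_on_eq_continuous_at by blast
  obtain c r e where c: "0 < c" and r: "0 < r" "r \<le> 1" and "0 < e"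
    and low: "\<And>t x. dist t0 t < e \<Longrightarrow> norm x < r \<Longrightarrow>
      rho M x \<le> c * cmod (\<Sum>k\<in>M. a t k * mixed_monomial k x)"
    by (rule uniform_lower_bound[OF cont theta]) (assumption, rule that)
  obtain e' where "0 < e'" "cball t0 e' \<subseteq> \<Delta>" using \<open>open \<Delta>\<close> t0 open_contains_cball by blast
  \<comment> \<open>Half of \<open>e\<close> keeps the closed ball \<open>T\<close> inside the open
    range of the lower bound; compactness of \<open>T\<close> gives uniform coefficient
    bounds.\<close>
  define \<delta> where "\<delta> = min (e / 2) e'"
  have \<delta>: "0 < \<delta>" "\<delta> < e" "cball t0 \<delta> \<subseteq> \<Delta>"
    using \<open>0 < e\<close> \<open>0 < e'\<close> \<open>cball t0 e' \<subseteq> \<Delta>\<close> by (auto simp: \<delta>_def)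
  define T where "T = cball t0 \<delta>"
  have T\<Delta>: "t \<in> \<Delta>" if "t \<in> T" for t using that \<delta> by (auto simp: T_def)
  have lowT: "rho M x \<le> c * cmod (mixed_eval (h t) x)" if "t \<in> T" "norm x < r" for t x
    using low[of t x] that \<delta>(2) H[OF T\<Delta>[OF that(1)]] by (simp add: T_def)

  have F_eval: "mixed_eval (F t) x = mixed_eval f x + t * mixed_eval g x" for t x
    unfolding F_def by (rule mixed_eval_pencil)
  \<comment> \<open>Two distinct parameters at which the pencil vanishes at 0 isolate
    \<open>g\<close>.\<close>
  have g0: "mixed_eval g 0 = 0"
  proof -
    have "t0 + of_real \<delta> \<in> \<Delta>" using \<delta> by (intro T\<Delta>) (simp add: T_def dist_norm)
    then have "mixed_eval f 0 + (t0 + of_real \<delta>) * mixed_eval g 0 = 0" "mixed_eval f 0 + t0 * mixed_eval g 0 = 0"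
      using assms(5) t0 by (simp_all flip: F_eval)
    moreover have "of_real \<delta> * mixed_eval g 0
        = (mixed_eval f 0 + (t0 + of_real \<delta>) * mixed_eval g 0) - (mixed_eval f 0 + t0 * mixed_eval g 0)"
      by (simp add: algebra_simps)
    ultimately have "of_real \<delta> * mixed_eval g 0 = 0" by simp
    then show ?thesis using \<delta>(1) by simp
  qed
  define v where "v i t x = - (mixed_eval g x * mixed_eval (P i t) x / mixed_eval (h t) x)" for i t x
  have v0: "v i t 0 = 0" for i t by (simp add: v_def g0)
  have "\<exists>L\<ge>0. \<forall>t\<in>T. \<forall>x y. norm x < r \<longrightarrow> norm y < r \<longrightarrow> cmod (v i t x - v i t y) \<le> L * norm (x - y)" for i
  proof -
    define N where "N = family_monomials \<Delta> (P i)"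
    have "finite N" using family_P by (simp add: N_def analytic_family_def family_monomials_def)
    moreover have "Poly_Mapping.keys (P i t) \<subseteq> N" if "t \<in> T" for t
      using T\<Delta>[OF that] unfolding N_def family_monomials_def by blast
    ultimately have N: "finite N" "\<And>t. t \<in> T \<Longrightarrow> Poly_Mapping.keys (P i t) \<subseteq> N" by blast+
    have "compact T" by (simp add: T_def)
    have subT: "T \<subseteq> \<Delta>" using T\<Delta> by blast
    obtain C' where C': "\<And>t l. t \<in> T \<Longrightarrow> l \<in> N \<Longrightarrow> cmod (Poly_Mapping.lookup (P i t) l) \<le> C'"
      using finite_family_bounded[OF \<open>compact T\<close> N(1), of "\<lambda>t. Poly_Mapping.lookup (P i t)"]
        continuous_on_subset[OF continuous_family_coeff[OF family_P] subT] by blast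
    obtain C where C: "\<And>t k. t \<in> T \<Longrightarrow> k \<in> M \<Longrightarrow> cmod (a t k) \<le> C"
      using finite_family_bounded[OF \<open>compact T\<close> finite, of a] continuous_on_subset[OF a_cont subT] by blast
    have dom: "dominated (fst (k + l) + snd (k + l))" if "k \<in> Poly_Mapping.keys g" "l \<in> N" for k l
      by (rule dominated_if_fil[OF that _ finite_keys N(1)]) (use fil[of _ i] in \<open>simp add: M_def N_def\<close>)
    obtain L where L: "0 \<le> L" "\<And>t x y. t \<in> T \<Longrightarrow> norm x < r \<Longrightarrow> norm y < r \<Longrightarrow>
        cmod (mixed_eval g x * mixed_eval (P i t) x / (\<Sum>k\<in>M. a t k * mixed_monomial k x) -
          mixed_eval g y * mixed_eval (P i t) y / (\<Sum>k\<in>M. a t k * mixed_monomial k y)) \<le> L * norm (x - y)"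
    proof (rule component_lipschitz[where p = "P i" and g = g and a = a and T = T and N = N
          and C = C and C' = C' and c = c and r = r])
      show "fst k + snd k \<noteq> 0" if "k \<in> Poly_Mapping.keys g" for k
        by (rule ordinary_exponent_nonzero[OF assms(3) g0 that])
    qed (use N C' C dom c r low \<delta>(2) in \<open>auto simp: T_def\<close>)
    have "cmod (v i t x - v i t y) \<le> L * norm (x - y)" if "t \<in> T" "norm x < r" "norm y < r" for t x y
      using L(2)[OF that] by (simp add: v_def H[OF T\<Delta>[OF that(1)]] norm_minus_commute)
    then show ?thesis using L(1) by blast
  qed
  then obtain Lv where Lv: "\<And>i. 0 \<le> Lv i"
    "\<And>i t x y. t \<in> T \<Longrightarrow> norm x < r \<Longrightarrow> norm y < r \<Longrightarrow> cmod (v i t x - v i t y) \<le> Lv i * norm (x - y)"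
    by metis
  have h_nonzero: "mixed_eval (h t) x \<noteq> 0" if "t \<in> T" "norm x < r" "x \<noteq> 0" for t x
  proof -
    have "cmod (x $ j) < 1" for j
      using that(2) r Finite_Cartesian_Product.norm_nth_le[of x j] by linarith
    then have "0 < rho M x" using rho_zero_off_origin that(3) by blast
    then show ?thesis using lowT[OF that(1,2)] by auto
  qed

  define r' where "r' = r / 2"
  have r': "0 < r'" "r' < r" using r by (auto simp: r'_def)
  \<comment> \<open>A Lipschitz bound in \<open>x\<close> uniform in \<open>t\<close>, with
    continuity in \<open>t\<close> for each fixed \<open>x\<close>, gives joint continuity; at
    \<open>x = 0\<close>, where the denominator vanishes, \<open>v\<close> is constantly 0.\<close>
  have v_cont: "continuous_on (T \<times> cball 0 r') (\<lambda>(t, x). v i t x)" for i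
  proof (rule continuous_on_TimesI)
    show "local_lipschitz T (cball 0 r') (v i)"
    proof (rule local_lipschitzI)
      fix t and x :: "complex ^ 'n"
      have "(Lv i)-lipschitz_on (cball x 1 \<inter> cball 0 r') (v i s)" if "s \<in> T" for s
        using Lv r' that by (intro lipschitz_onI) (auto simp: dist_norm)
      then show "\<exists>u>0. \<exists>L. \<forall>s\<in>cball t u \<inter> T. L-lipschitz_on (cball x u \<inter> cball 0 r') (v i s)"
        by (intro exI[of _ 1] conjI exI[of _ "Lv i"]) auto
    qed
    fix x :: "complex ^ 'n" assume x: "x \<in> cball 0 r'"
    show "continuous_on T (\<lambda>t. v i t x)"
    proof (cases "x = 0")
      case False
      have subT: "T \<subseteq> \<Delta>" using T\<Delta> by blast
      have ev: "continuous_on T (\<lambda>t. mixed_eval (q t) x)" if "analytic_family \<Delta> q" for q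
      proof -
        have "continuous_on T (\<lambda>t. \<Sum>k\<in>family_monomials \<Delta> q. Poly_Mapping.lookup (q t) k * mixed_monomial k x)"
          by (intro continuous_intros continuous_on_subset[OF continuous_family_coeff[OF that] subT])
        then show ?thesis
          by (rule continuous_on_eq) (simp add: mixed_eval_family[OF that T\<Delta>])
      qed
      show ?thesis unfolding v_def
        by (intro continuous_intros ev family_P family_h) (use h_nonzero x r' False in auto)
    qed (simp add: v0)
  qed

  \<comment> \<open>Retractions onto closed balls extend the field to all parameters and points, as
    \<open>ray_flow\<close> requires; being 1-Lipschitz, \<open>px\<close> keeps the Lipschitz
    constant.\<close>
  define pt where "pt = closest_point (cball (0::complex) \<delta>)"
  define px where "px = closest_point (cball (0::complex ^ 'n) r')"
  have pt: "t0 + pt b \<in> T" for b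
    using closest_point_in_set[of "cball (0::complex) \<delta>" b] \<delta>(1) by (simp add: pt_def T_def dist_norm)
  have px: "norm (px x) \<le> r'" for x
    using closest_point_in_set[of "cball (0::complex ^ 'n) r'" x] r'(1) by (simp add: px_def)
  have px_id: "px x = x" if "norm x \<le> r'" for x
    using closest_point_self[of x "cball 0 r'"] that by (simp add: px_def)
  have pt_id: "pt b = b" if "norm b \<le> \<delta>" for b
    using closest_point_self[of b "cball 0 \<delta>"] that by (simp add: pt_def)
  have px_lip: "norm (px x - px y) \<le> norm (x - y)" for x y
    using closest_point_lipschitz[of "cball (0::complex ^ 'n) r'" x y] r'(1) by (simp add: px_def dist_norm)
  \<comment> \<open>The factor \<open>b\<close> is the velocity of the parameter on the segment from
    \<open>t0\<close> to \<open>t0 + b\<close>.\<close>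
  define G :: "complex \<Rightarrow> complex \<Rightarrow> complex ^ 'n \<Rightarrow> complex ^ 'n" where
    "G b s x = (\<chi> i. b * v i (t0 + pt s) (px x))" for b s x
  define L where "L = (\<Sum>i\<in>UNIV. Lv i)"
  have L: "0 \<le> L" by (simp add: L_def sum_nonneg Lv(1))
  have px0: "px 0 = 0" using px_id[of 0] r'(1) by simp
  have G_lip: "norm (G b s x - G b s y) \<le> L * norm b * norm (x - y)" for b s x y
  proof -
    have "norm (G b s x - G b s y) \<le> (\<Sum>i\<in>UNIV. norm ((G b s x - G b s y) $ i))"
      unfolding norm_vec_def by (intro L2_set_le_sum) simp
    also have "\<dots> \<le> (\<Sum>i\<in>UNIV. Lv i * norm b * norm (x - y))"
    proof (rule sum_mono)
      fix i
      have "norm ((G b s x - G b s y) $ i) = norm b * cmod (v i (t0 + pt s) (px x) - v i (t0 + pt s) (px y))"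
        by (simp add: G_def norm_mult flip: right_diff_distrib)
      also have "\<dots> \<le> norm b * (Lv i * norm (px x - px y))"
        using px[of x] px[of y] r'(2) pt by (intro mult_left_mono Lv(2)) auto
      also have "\<dots> \<le> norm b * (Lv i * norm (x - y))"
        using px_lip Lv(1) by (intro mult_left_mono) auto
      finally show "norm ((G b s x - G b s y) $ i) \<le> Lv i * norm b * norm (x - y)"
        by (simp add: algebra_simps)
    qed
    finally show ?thesis by (simp add: L_def sum_distrib_right)
  qed
  have G0: "G b s 0 = 0" for b s by (simp add: G_def px0 v0 vec_eq_iff)
  \<comment> \<open>Idempotence of \<open>px\<close> allows the Lipschitz bound to be applied
    between \<open>px x\<close> and 0, which bounds \<open>G\<close> globally.\<close>
  have G_px: "G b s x = G b s (px x)" for b s x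
    using px_id[OF px[of x]] by (simp add: G_def)
  have G_bound: "norm (G b s x) \<le> (L * r') * norm b" for b s x
  proof -
    have "norm (G b s x) \<le> L * norm b * norm (px x)"
      using G_lip[of b s "px x" 0] G0 by (simp flip: G_px)
    also have "\<dots> \<le> L * norm b * r'" using L px by (intro mult_left_mono) auto
    finally show ?thesis by (simp add: algebra_simps)
  qed
  have G_cont: "continuous_on UNIV (\<lambda>(b, s, x). G b s x)"
  proof -
    have "continuous_on UNIV (\<lambda>z::complex \<times> complex \<times> (complex ^ 'n). v i (t0 + pt (fst (snd z))) (px (snd (snd z))))" for i
    proof -
      have cl: "continuous_on UNIV pt" "continuous_on UNIV px"
        unfolding pt_def px_def using \<delta>(1) r'(1) by (auto intro!: continuous_on_closest_point)
      have "continuous_on UNIV (\<lambda>z::complex \<times> complex \<times> (complex ^ 'n). pt (fst (snd z)))"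
        by (rule continuous_on_compose2[OF cl(1)]) (auto intro!: continuous_intros)
      moreover have "continuous_on UNIV (\<lambda>z::complex \<times> complex \<times> (complex ^ 'n). px (snd (snd z)))"
        by (rule continuous_on_compose2[OF cl(2)]) (auto intro!: continuous_intros)
      ultimately have "continuous_on UNIV
          (\<lambda>z::complex \<times> complex \<times> (complex ^ 'n). (t0 + pt (fst (snd z)), px (snd (snd z))))"
        by (intro continuous_intros)
      from continuous_on_compose2[OF v_cont[of i] this] show ?thesis
        using pt px by (simp add: image_subset_iff)
    qed
    then show ?thesis unfolding G_def case_prod_beta
      by (intro continuous_on_vec_lambda continuous_intros)
  qed
  have G_scale: "G (s *\<^sub>R b) u x = s *\<^sub>R G b u x" for s b u x
    by (simp add: G_def vec_eq_iff)
  \<comment> \<open>\<open>L + 1\<close> keeps the denominator positive when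
    \<open>L = 0\<close>.\<close>
  define d where "d = min \<delta> (1 / (3 * (L + 1)))"
  have d: "0 < d" "d \<le> \<delta>" "d * L \<le> 1 / 3"
  proof -
    show "0 < d" "d \<le> \<delta>" using \<delta>(1) L by (auto simp: d_def)
    have "d * L \<le> 1 / (3 * (L + 1)) * L" using L by (intro mult_right_mono) (auto simp: d_def)
    also have "\<dots> \<le> 1 / 3" using L by (simp add: field_simps)
    finally show "d * L \<le> 1 / 3" .
  qed
  have Lr: "0 \<le> L * r'" using r'(1) L by simp
  obtain X where X: "continuous_on UNIV (\<lambda>(b, x). X b x)" "\<And>b. X b 0 = 0" "\<And>x. X 0 x = x"
    "\<And>b x y. norm ((X b x - x) - (X b y - y)) \<le> (1 / 2) * norm (x - y)"
    "\<And>b x s. norm b \<le> d \<Longrightarrow> s \<in> {0..1} \<Longrightarrow>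
      ((\<lambda>s. X (s *\<^sub>R b) x) has_vector_derivative G b (s *\<^sub>R b) (X (s *\<^sub>R b) x)) (at s within {0..1})"
    by (rule ray_flow[OF G_cont G_lip G_bound G0 G_scale L Lr d(1,3)]) (rule that)
  have X_disp: "norm (X b x - x) \<le> (1 / 2) * norm x" for b x
    using X(4)[of b x 0] X(2) by simp
  have X_norm: "norm (X b x) \<le> (3 / 2) * norm x" for b x
    using norm_triangle_ineq[of "X b x - x" x] X_disp[of b x] by simp
  \<comment> \<open>A displacement of at most half the norm cannot reach the origin, so
    \<open>h\<close> stays nonzero along the trajectories considered below.\<close>
  have X_nonzero: "X b x \<noteq> 0" if "x \<noteq> 0" for b x
    using X_disp[of b x] that by auto
  \<comment> \<open>Norms grow by a factor of at most 3/2, so trajectories from the half ball stay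
    within radius \<open>r'\<close>, where \<open>px\<close> is the identity.\<close>
  define V where "V = ball (0::complex ^ 'n) (r' / 2)"
  define \<phi> where "\<phi> t = X (t - t0)" for t
  have trivial: "mixed_eval (F t) (\<phi> t x) = mixed_eval (F t0) x" if t: "t \<in> ball t0 d" and x: "x \<in> V" for t x
  proof (cases "x = 0")
    case True
    have "t \<in> \<Delta>" using t d(2) by (intro T\<Delta>) (simp add: T_def)
    then show ?thesis using True assms(5) t0 by (simp add: \<phi>_def X(2))
  next
    case False
    define b where "b = t - t0"
    have b: "norm b \<le> d" using t by (simp add: b_def dist_norm norm_minus_commute)
    define \<gamma> where "\<gamma> s = X (s *\<^sub>R b) x" for s
    have "mixed_eval (f + Poly_Mapping.map (\<lambda>c. (t0 + b) * c) g) (\<gamma> 1)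
        = mixed_eval (f + Poly_Mapping.map (\<lambda>c. t0 * c) g) (\<gamma> 0)"
    proof (rule pencil_constant_along_curve[OF assms(2,3)])
      fix s :: real assume s: "s \<in> {0..1}"
      show "(\<gamma> has_vector_derivative G b (s *\<^sub>R b) (\<gamma> s)) (at s within {0..1})"
        unfolding \<gamma>_def[abs_def] by (rule X(5)[OF b s])
      have sb: "norm (s *\<^sub>R b) \<le> \<delta>"
        using b s d(2) mult_left_le_one_le[of "norm b" s] by simp
      have tT: "t0 + s *\<^sub>R b \<in> T" using sb by (simp add: T_def dist_norm)
      have \<gamma>r: "norm (\<gamma> s) \<le> r'" using X_norm[of "s *\<^sub>R b" x] x r'(1) by (simp add: \<gamma>_def V_def)
      have h0: "mixed_eval (h (t0 + s *\<^sub>R b)) (\<gamma> s) \<noteq> 0"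
        using h_nonzero[OF tT] \<gamma>r r'(2) X_nonzero[OF False] by (simp add: \<gamma>_def)
      have "(\<Sum>i\<in>UNIV. partial_deriv i (mixed_eval (F (t0 + s *\<^sub>R b))) (\<gamma> s) * G b (s *\<^sub>R b) (\<gamma> s) $ i)
          = (\<Sum>i\<in>UNIV. (- b * mixed_eval g (\<gamma> s) / mixed_eval (h (t0 + s *\<^sub>R b)) (\<gamma> s)) *
            (mixed_eval (P i (t0 + s *\<^sub>R b)) (\<gamma> s) * partial_deriv i (mixed_eval (F (t0 + s *\<^sub>R b))) (\<gamma> s)))"
        by (intro sum.cong refl) (simp add: G_def v_def pt_id[OF sb] px_id[OF \<gamma>r])
      \<comment> \<open>The products of \<open>P i\<close> with the partial derivatives sum to
        \<open>h\<close>, which cancels the denominator.\<close>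
      also have "\<dots> = - b * mixed_eval g (\<gamma> s)"
        unfolding sum_distrib_left[symmetric] using hP[OF T\<Delta>[OF tT]] h0 by simp
      finally show "(\<Sum>i\<in>UNIV. partial_deriv i (mixed_eval (f + Poly_Mapping.map (\<lambda>c. (t0 + s *\<^sub>R b) * c) g)) (\<gamma> s)
          * G b (s *\<^sub>R b) (\<gamma> s) $ i) = - b * mixed_eval g (\<gamma> s)"
        by (simp only: F_def)
    qed
    then show ?thesis by (simp add: F_def \<gamma>_def X(3) \<phi>_def b_def)
  qed
  show "\<exists>U V \<phi>. open U \<and> t0 \<in> U \<and> U \<subseteq> \<Delta> \<and> open V \<and> 0 \<in> V \<and>
       continuous_on (U \<times> V) (\<lambda>(t, x). \<phi> t x) \<and>
       (\<forall>t\<in>U. \<phi> t 0 = 0 \<and> (\<exists>W. open W \<and> bilipschitz_homeo V W (\<phi> t)) \<and>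
              (\<forall>x\<in>V. mixed_eval (F t) (\<phi> t x) = mixed_eval (F t0) x))"
  proof (rule exI[of _ "ball t0 d"], rule exI[of _ V], rule exI[of _ \<phi>], intro conjI ballI)
    show "ball t0 d \<subseteq> \<Delta>" using T\<Delta> d(2) by (auto simp: T_def)
    show "continuous_on (ball t0 d \<times> V) (\<lambda>(t, x). \<phi> t x)"
      unfolding \<phi>_def case_prod_beta
      using continuous_on_compose2[OF X(1), of "ball t0 d \<times> V" "\<lambda>z. (fst z - t0, snd z)"]
      by (simp add: case_prod_beta continuous_intros)
    fix t assume "t \<in> ball t0 d"
    have "open V" by (simp add: V_def)
    then show "\<exists>W. open W \<and> bilipschitz_homeo V W (\<phi> t)"
      using bilipschitz_homeo_perturbation[of V "X (t - t0)"] X(4) unfolding \<phi>_def by blast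
  qed (use trivial d(1) r'(1) X(2) in \<open>auto simp: V_def \<phi>_def\<close>)
qed

end
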